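(* Let $\Lambda(\varphi)=\xi_\tau(6+i\varphi)$ be the Ramanujan-Wilton function, and for each integer $s\ge0$ let $$\chi(s)=2\int_0^1 L(i\omega)\,\omega^5\,\frac{(\ln\omega)^{2s}}{(2s)!}\,d\omega.$$ Then for all $\varphi\in\mathbb{C}$, $$\Lambda(\varphi)=\sum_{s=0}^\infty\chi(s)(-1)^s\varphi^{2s}.$$
   Context: For $\Im(x)>0$, $L(x)=q\prod_{n=1}^\infty(1-q^n)^{24}=\sum_{m=1}^\infty\tau(m)q^m$ with $q=e^{2\pi i x}$; this defines the Ramanujan function $\tau(m)$. The Ramanujan zeta function is $H_\tau(x)=\sum_{\ell=1}^\infty \tau(\ell)\ell^{-x}$ for $\Re(x)>13/2$, and $H_\tau$ also denotes its analytic continuation to $\mathbb{C}$. The Ramanujan-Rankin function $\xi_\tau(x)=(2\pi)^{-x}\Gamma(x)H_\tau(x)$ extends to an entire function of $x\in\mathbb{C}$ (denoted by the same symbol). *)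

theory Defs
  imports "HOL-Complex_Analysis.Complex_Analysis"
begin

definition nome :: "complex \<Rightarrow> complex" where
  "nome x = exp (2 * of_real pi * \<i> * x)"

definition ramanujan_L :: "complex \<Rightarrow> complex" where
  "ramanujan_L x = nome x * (\<Prod>n. (1 - nome x ^ Suc n) ^ 24)"

text \<open>
  The coefficients of the $q$-expansion. They are only meaningful for $m \geq 1$; the value
  at \<open>0\<close> is fixed so that the description is unique.
\<close>

definition ramanujan_tau :: "nat \<Rightarrow> complex" where
  "ramanujan_tau = (THE t. t 0 = 0 \<and>
     (\<forall>x. Im x > 0 \<longrightarrow> (\<lambda>m. t (Suc m) * nome x ^ Suc m) sums ramanujan_L x))"

definition ramanujan_dirichlet_series :: "complex \<Rightarrow> complex" where
  "ramanujan_dirichlet_series x = (\<Sum>l. ramanujan_tau (Suc l) * of_nat (Suc l) powr (-x))"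

definition ramanujan_zeta :: "complex \<Rightarrow> complex" where
  "ramanujan_zeta = (THE f. f holomorphic_on UNIV \<and>
     (\<forall>x. Re x > 13 / 2 \<longrightarrow> f x = ramanujan_dirichlet_series x))"

text \<open>
  In the library \<open>Gamma\<close> takes the value \<open>0\<close> at its poles, so the product
  formula is required only away from them and the values there are those of the entire extension.
\<close>

definition ramanujan_xi :: "complex \<Rightarrow> complex" where
  "ramanujan_xi = (THE f. f holomorphic_on UNIV \<and>
     (\<forall>x. x \<notin> \<int>\<^sub>\<le>\<^sub>0 \<longrightarrow> f x = of_real (2 * pi) powr (-x) * Gamma x * ramanujan_zeta x))"

definition ramanujan_wilton :: "complex \<Rightarrow> complex" where
  "ramanujan_wilton \<phi> = ramanujan_xi (6 + \<i> * \<phi>)"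

definition chi :: "nat \<Rightarrow> complex" where
  "chi s = 2 * integral {0..1} (\<lambda>w::real. ramanujan_L (\<i> * of_real w) * of_real w ^ 5 *
     (of_real (ln w) ^ (2 * s) / fact (2 * s)))"

end

(*
  The Jacobi-type product theta t u = (1-w) prod_n (1 - q^n w) (1 - q^n / w), with w = exp(2 pi i u)
  and q = exp(2 pi i t), is quasi-elliptic in u with simple zeros at the lattice Z + Z t. By Liouville
  it agrees, up to an exponential of a quadratic polynomial and a constant C, with theta (-1/t) (u/t).
  Evaluating at the three half-periods determines C^3 and comparing derivatives at 0 gives
  L(-1/t) = t^12 L(t).

  Hence |L(z)| (Im z)^6 is bounded, and the mean square of L on the line Im z = 1/N gives
  sum_{n <= N} |tau(n)|^2 = O(N^12). By Cauchy-Schwarz the Dirichlet series converges absolutely for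
  Re x > 13/2 and can be integrated term by term: (2 pi)^(-x) Gamma(x) H(x) is the Mellin transform
  of L(i w). Folding (1, oo) onto (0, 1) by w -> 1/w turns it into
  2 * integral_0^1 L(i w) w^5 cos(phi ln w) dw for x = 6 + i phi. Expanding the cosine gives a power
  series in phi that converges everywhere, which therefore also provides the entire extensions.
*)
theory Submission
  imports Defs
begin

section \<open>Infinite products\<close>

text \<open>Pointwise, the bound on |L(z)| (Im z)^6 yields only tau(n) = O(n^6), hence absolute
  convergence for Re x > 7. The definition of H asks for agreement with the series on all of Re x >
  13/2; bounding the coefficients in mean square instead gains exactly this missing half. In the
  inversion formula the theta product carries no factor (q;q), so the product of its values at the
  three half-periods is the constant 2 for every modulus. L enters only through the derivative at 0,
  which is a multiple of (q;q)^2. The fourth power of the resulting identity between cubes produces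
  weight 12 and the 24th power and removes a leftover fourth root of unity, so no branch of a square
  root of the modulus ever has to be chosen. tau, H and xi are definite descriptions, so each of
  them has to be opened by an existence and a uniqueness argument.\<close>

lemma summable_imp_convergent_to_prodinf:
  fixes f :: "nat \<Rightarrow> complex"
  assumes "summable (\<lambda>n. norm (f n))"
  shows "(\<lambda>n. 1 + f n) has_prod (\<Prod>n. 1 + f n)" "(\<lambda>N. \<Prod>n<N. 1 + f n) \<longlonglongrightarrow> (\<Prod>n. 1 + f n)"
proof -
  have "convergent_prod (\<lambda>n. 1 + f n)"
    by (rule abs_convergent_prod_imp_convergent_prod) (use assms in \<open>simp add: abs_convergent_prod_conv_summable\<close>)
  thus *: "(\<lambda>n. 1 + f n) has_prod (\<Prod>n. 1 + f n)" by blast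
  from has_prod_imp_tendsto'[OF this]
  show "(\<lambda>N. \<Prod>n<N. 1 + f n) \<longlonglongrightarrow> (\<Prod>n. 1 + f n)" .
qed

text \<open>On a closed ball the majorant makes the sums of norms converge uniformly; this passes to
  the partial products, and locally uniform limits of holomorphic functions are holomorphic.\<close>

lemma holomorphic_prodinf:
  fixes f :: "nat \<Rightarrow> complex \<Rightarrow> complex"
  assumes "open S" and hol: "\<And>n. f n holomorphic_on S"
    and bd: "\<And>K. compact K \<Longrightarrow> K \<subseteq> S \<Longrightarrow> \<exists>M. summable M \<and> (\<forall>n. \<forall>z\<in>K. norm (f n z) \<le> M n)"
  shows "(\<lambda>z. \<Prod>n. 1 + f n z) holomorphic_on S"
proof (rule holomorphic_uniform_sequence[OF \<open>open S\<close>])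
  show "(\<lambda>z. \<Prod>n<N. 1 + f n z) holomorphic_on S" for N
    by (intro holomorphic_intros hol)
next
  fix x assume "x \<in> S"
  then obtain d where d: "d > 0" "cball x d \<subseteq> S"
    using \<open>open S\<close> open_contains_cball by blast
  from bd[OF _ d(2)] obtain M where M: "summable M" "\<And>n z. z \<in> cball x d \<Longrightarrow> norm (f n z) \<le> M n"
    by auto
  have "uniformly_convergent_on (cball x d) (\<lambda>N z. \<Sum>n<N. norm (f n z))"
    by (rule Weierstrass_m_test'[OF _ M(1)]) (use M(2) in auto)
  moreover have "continuous_on (cball x d) (f n)" for n
    using continuous_on_subset[OF holomorphic_on_imp_continuous_on[OF hol] d(2)] .
  ultimately have "uniformly_convergent_on (cball x d) (\<lambda>N z. \<Prod>n<N. 1 + f n z)"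
    by (intro uniformly_convergent_on_prod) auto
  then obtain g where g: "uniform_limit (cball x d) (\<lambda>N z. \<Prod>n<N. 1 + f n z) g sequentially"
    by (auto simp: uniformly_convergent_on_def)
  have "g z = (\<Prod>n. 1 + f n z)" if "z \<in> cball x d" for z
  proof (rule LIMSEQ_unique[OF tendsto_uniform_limitI[OF g that]])
    show "(\<lambda>N. \<Prod>n<N. 1 + f n z) \<longlonglongrightarrow> (\<Prod>n. 1 + f n z)"
      by (rule summable_imp_convergent_to_prodinf, rule summable_comparison_test'[OF M(1), of 0])
        (use M(2)[OF that] in auto)
  qed
  hence "uniform_limit (cball x d) (\<lambda>N z. \<Prod>n<N. 1 + f n z) (\<lambda>z. \<Prod>n. 1 + f n z) sequentially"
    using g by (subst uniform_limit_cong'[where i = g]) auto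
  with d show "\<exists>d>0. cball x d \<subseteq> S \<and>
      uniform_limit (cball x d) (\<lambda>N z. \<Prod>n<N. 1 + f n z) (\<lambda>z. \<Prod>n. 1 + f n z) sequentially"
    by blast
qed

text \<open>The q-Pochhammer symbol (a;q) with infinitely many factors. \<open>qprod q q\<close> is
  Euler's function, whose 24th power times q is the discriminant.\<close>

definition qprod :: "complex \<Rightarrow> complex \<Rightarrow> complex" where
  "qprod a q = (\<Prod>n. 1 - a * q ^ n)"

lemma qprod_has_prod:
  assumes "norm q < 1"
  shows "(\<lambda>n. 1 - a * q ^ n) has_prod qprod a q"
  using summable_imp_convergent_to_prodinf(1)[of "\<lambda>n. - a * q ^ n"] assms
  by (simp add: qprod_def norm_mult norm_power summable_mult)

lemma qprod_LIMSEQ: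
  assumes "norm q < 1"
  shows "(\<lambda>N. \<Prod>n<N. 1 - a * q ^ n) \<longlonglongrightarrow> qprod a q"
  using has_prod_imp_tendsto'[OF qprod_has_prod[OF assms]] .

lemma qprod_eq_0_iff:
  assumes "norm q < 1"
  shows "qprod a q = 0 \<longleftrightarrow> (\<exists>n. a * q ^ n = 1)"
proof -
  have "0 = 1 - x \<longleftrightarrow> x = 1" for x :: complex by auto
  thus ?thesis
    using has_prod_eq_0_iff[OF qprod_has_prod[OF assms, of a]] by (simp add: image_iff)
qed

lemma qprod_rec:
  assumes "norm q < 1"
  shows "qprod a q = (1 - a) * qprod (a * q) q"
proof (rule LIMSEQ_unique)
  show "(\<lambda>N. \<Prod>n<Suc N. 1 - a * q ^ n) \<longlonglongrightarrow> qprod a q"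
    using qprod_LIMSEQ[OF assms] by (rule LIMSEQ_Suc)
  have "(\<lambda>N. (1 - a) * (\<Prod>n<N. 1 - a * q * q ^ n)) \<longlonglongrightarrow> (1 - a) * qprod (a * q) q"
    by (intro tendsto_intros qprod_LIMSEQ assms)
  thus "(\<lambda>N. \<Prod>n<Suc N. 1 - a * q ^ n) \<longlonglongrightarrow> (1 - a) * qprod (a * q) q"
    unfolding prod.lessThan_Suc_shift by (simp add: mult.assoc)
qed

lemma qprod_mult_minus:
  assumes "norm q < 1"
  shows "qprod a q * qprod (-a) q = qprod (a\<^sup>2) (q\<^sup>2)"
proof (rule LIMSEQ_unique)
  show "(\<lambda>N. (\<Prod>n<N. 1 - a * q ^ n) * (\<Prod>n<N. 1 - (-a) * q ^ n)) \<longlonglongrightarrow> qprod a q * qprod (-a) q"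
    by (intro tendsto_intros qprod_LIMSEQ assms)
  have *: "norm (q\<^sup>2) < 1" using assms by (simp add: norm_power power_less_one_iff)
  have "(1 - a * q ^ n) * (1 - (-a) * q ^ n) = 1 - a\<^sup>2 * (q\<^sup>2) ^ n" for n
    by (simp add: algebra_simps power2_eq_square power_mult_distrib)
  thus "(\<lambda>N. (\<Prod>n<N. 1 - a * q ^ n) * (\<Prod>n<N. 1 - (-a) * q ^ n)) \<longlonglongrightarrow> qprod (a\<^sup>2) (q\<^sup>2)"
    using qprod_LIMSEQ[OF *, of "a\<^sup>2"] by (simp flip: prod.distrib)
qed

lemma qprod_even_odd:
  assumes "norm q < 1"
  shows "qprod a (q\<^sup>2) * qprod (a * q) (q\<^sup>2) = qprod a q"
proof (rule LIMSEQ_unique)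
  have *: "norm (q\<^sup>2) < 1" using assms by (simp add: norm_power power_less_one_iff)
  show "(\<lambda>N. (\<Prod>n<N. 1 - a * (q\<^sup>2) ^ n) * (\<Prod>n<N. 1 - a * q * (q\<^sup>2) ^ n))
          \<longlonglongrightarrow> qprod a (q\<^sup>2) * qprod (a * q) (q\<^sup>2)"
    by (intro tendsto_intros qprod_LIMSEQ *)
  have "(\<Prod>n<2*N. 1 - a * q ^ n) = (\<Prod>n<N. 1 - a * (q\<^sup>2) ^ n) * (\<Prod>n<N. 1 - a * q * (q\<^sup>2) ^ n)" for N
    by (induction N) (simp_all add: power_mult)
  moreover have "(\<lambda>N. \<Prod>n<2*N. 1 - a * q ^ n) \<longlonglongrightarrow> qprod a q"
    by (rule LIMSEQ_subseq_LIMSEQ[OF qprod_LIMSEQ[OF assms], of "\<lambda>N. 2 * N", unfolded o_def])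
      (simp add: strict_mono_def)
  ultimately show "(\<lambda>N. (\<Prod>n<N. 1 - a * (q\<^sup>2) ^ n) * (\<Prod>n<N. 1 - a * q * (q\<^sup>2) ^ n)) \<longlonglongrightarrow> qprod a q"
    by simp
qed

lemma qprod_self_nonzero:
  assumes "norm q < 1"
  shows "qprod q q \<noteq> 0"
proof
  assume "qprod q q = 0"
  then obtain n where "q ^ Suc n = 1" by (auto simp: qprod_eq_0_iff[OF assms])
  hence "norm q ^ Suc n = 1" by (metis norm_one norm_power)
  moreover have "norm q ^ Suc n < 1"
    using power_strict_mono[OF assms, of "Suc n"] by simp
  ultimately show False by simp
qed

text \<open>With q = r^2 the last two factors merge into (q;q^2), and the claim becomes Euler's
  identity between partitions into distinct and into odd parts. It follows by multiplying with
  (q;q), regrouping the factors and cancelling.\<close>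

lemma euler_qprod:
  assumes "norm r < 1"
  shows "qprod (-(r\<^sup>2)) (r\<^sup>2) * qprod r (r\<^sup>2) * qprod (-r) (r\<^sup>2) = 1"
proof -
  define q where "q = r\<^sup>2"
  have q: "norm q < 1" using assms by (simp add: q_def norm_power power_less_one_iff)
  have "qprod (-q) q * qprod r q * qprod (-r) q * qprod q q
      = (qprod q q * qprod (-q) q) * (qprod r q * qprod (-r) q)"
    by (simp add: mult_ac)
  also have "\<dots> = qprod (q\<^sup>2) (q\<^sup>2) * qprod q (q\<^sup>2)"
    using qprod_mult_minus[OF q, of q] qprod_mult_minus[OF q, of r] by (simp add: q_def)
  also have "\<dots> = qprod q q"
    using qprod_even_odd[OF q, of q] by (simp add: power2_eq_square mult_ac)
  finally show ?thesis using qprod_self_nonzero[OF q] by (simp add: q_def)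
qed

lemma holomorphic_qprod:
  assumes "norm q < 1"
  shows "(\<lambda>a. qprod a q) holomorphic_on UNIV"
proof -
  have "(\<lambda>a. \<Prod>n. 1 + (- a * q ^ n)) holomorphic_on UNIV"
  proof (rule holomorphic_prodinf)
    fix K :: "complex set" assume "compact K"
    then obtain B where B: "\<And>z. z \<in> K \<Longrightarrow> norm z \<le> B"
      using compact_imp_bounded[of K] unfolding bounded_iff by blast
    show "\<exists>M. summable M \<and> (\<forall>n. \<forall>z\<in>K. norm (- z * q ^ n) \<le> M n)"
      by (rule exI[of _ "\<lambda>n. B * norm q ^ n"])
        (use assms B in \<open>auto simp: norm_mult norm_power summable_mult intro!: mult_right_mono\<close>)
  qed (auto intro!: holomorphic_intros)
  thus ?thesis by (simp add: qprod_def)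
qed

lemma holomorphic_qprod_self: "(\<lambda>q. qprod q q) holomorphic_on ball 0 1"
proof -
  have "(\<lambda>q. \<Prod>n. 1 + (- q * q ^ n)) holomorphic_on ball 0 1"
  proof (rule holomorphic_prodinf)
    fix K :: "complex set" assume K: "compact K" "K \<subseteq> ball 0 1"
    show "\<exists>M. summable M \<and> (\<forall>n. \<forall>z\<in>K. norm (- z * z ^ n) \<le> M n)"
    proof (cases "K = {}")
      case False
      then obtain w where w: "w \<in> K" "\<And>z. z \<in> K \<Longrightarrow> norm z \<le> norm w"
        using continuous_attains_sup[OF K(1), of norm] by (auto intro!: continuous_intros)
      show ?thesis
        by (rule exI[of _ "\<lambda>n. norm w ^ Suc n"])
          (use K(2) w in \<open>auto simp: norm_mult norm_power summable_mult intro!: mult_mono power_mono\<close>)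
    qed (auto intro!: exI[of _ "\<lambda>_. 0"])
  qed (auto intro!: holomorphic_intros)
  thus ?thesis by (simp add: qprod_def)
qed

section \<open>The inversion formula for the discriminant\<close>

text \<open>Equal multipliers make f/g doubly periodic. All its possible poles are lattice points,
  hence translates of 0, where the simple zero of g is cancelled by the zero of f. The quotient is
  therefore entire and bounded, so constant, with value F/G.\<close>

lemma quasi_elliptic_proportional:
  fixes f g \<mu> :: "complex \<Rightarrow> complex"
  assumes \<tau>: "Im \<tau> > 0"
    and f: "f holomorphic_on UNIV" "\<And>u. f (u + 1) = f u" "\<And>u. f (u + \<tau>) = \<mu> u * f u"
    and g: "g holomorphic_on UNIV" "\<And>u. g (u + 1) = g u" "\<And>u. g (u + \<tau>) = \<mu> u * g u"
    and \<mu>: "\<And>u. \<mu> u \<noteq> 0"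
    and zeros: "\<And>u. g u = 0 \<Longrightarrow> \<exists>m n :: int. u = of_int m + of_int n * \<tau>"
    and zero: "f 0 = 0" "g 0 = 0"
    and f': "(f has_field_derivative F) (at 0)"
    and g': "(g has_field_derivative G) (at 0)" and "G \<noteq> 0"
    and u: "g u \<noteq> 0"
  shows "f u * G = F * g u"
proof -
  \<comment> \<open>By l'Hopital's rule F/G is the limit of f/g at 0. Since the multiplier has no
    zeros, g vanishes at u iff it vanishes at u + \<open>\<tau>\<close>, so \<open>h\<close> is
    periodic at the filled-in points too.\<close>
  define h where "h u = (if g u = 0 then F / G else f u / g u)" for u
  interpret p1: periodic_fun_simple' h
    by standard (simp add: h_def f g)
  interpret p\<tau>: periodic_fun_simple h \<tau>
    by standard (simp add: h_def f g \<mu>)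
  have per: "h (z + (of_int m + of_int n * \<tau>)) = h z" for z and m n :: int
    using p1.plus_of_int[of "z + of_int n * \<tau>" m] p\<tau>.plus_of_int[of z n]
    by (simp add: add_ac)

  have "((\<lambda>w. (g w - g 0) / (w - 0)) \<longlongrightarrow> G) (at 0)"
    using g' has_field_derivativeD by blast
  from tendsto_imp_eventually_ne[OF this \<open>G \<noteq> 0\<close>]
  have "eventually (\<lambda>w. g w \<noteq> 0) (at 0)"
    by eventually_elim (use zero in auto)
  then obtain e where e: "e > 0" "\<And>w. w \<in> ball 0 e \<Longrightarrow> w \<noteq> 0 \<Longrightarrow> g w \<noteq> 0"
    unfolding eventually_at by (auto simp: dist_commute)
  have hol0: "h holomorphic_on ball 0 e"
  proof (rule no_isolated_singularity'[of "{0}"])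
    have "(\<lambda>w. f w / g w) holomorphic_on ball 0 e - {0}"
      using e by (intro holomorphic_intros holomorphic_on_subset[OF f(1)] holomorphic_on_subset[OF g(1)]) auto
    thus "h holomorphic_on ball 0 e - {0}"
      by (rule holomorphic_transform) (use e in \<open>auto simp: h_def\<close>)
    fix z :: complex assume "z \<in> {0}"
    hence [simp]: "z = 0" by simp
    have "((\<lambda>w. f w / g w) \<longlongrightarrow> F / G) (at 0)"
      by (rule lhopital_complex_simple[OF f' g']) (use zero \<open>G \<noteq> 0\<close> in auto)
    moreover have "eventually (\<lambda>w. f w / g w = h w) (at 0)"
      using \<open>eventually (\<lambda>w. g w \<noteq> 0) (at 0)\<close> by eventually_elim (simp add: h_def)
    ultimately have "(h \<longlongrightarrow> F / G) (at 0)"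
      by (rule Lim_transform_eventually)
    hence "(h \<longlongrightarrow> h 0) (at 0)" by (simp add: h_def zero)
    thus "(h \<longlongrightarrow> h z) (at z within ball 0 e)"
      using tendsto_within_subset by fastforce
  qed auto

  have "h field_differentiable at z" for z
  proof (cases "g z = 0")
    case True
    then obtain m n :: int where z: "z = of_int m + of_int n * \<tau>" using zeros by blast
    have hz: "h (w - z) = h w" for w
      using per[of "w - z" m n] by (simp add: z)
    have "(\<lambda>w. h (w - z)) holomorphic_on ball z e"
      by (rule holomorphic_on_compose_gen[OF _ hol0, unfolded o_def])
        (auto intro!: holomorphic_intros simp: dist_norm norm_minus_commute)
    hence "h holomorphic_on ball z e" by (simp only: hz)
    thus ?thesis
      using e(1) by (intro holomorphic_on_imp_differentiable_at[of _ "ball z e"]) auto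
  next
    case False
    have op: "open (g -` (-{0}))"
      by (intro open_vimage holomorphic_on_imp_continuous_on[OF g(1)]) auto
    have "(\<lambda>w. f w / g w) holomorphic_on (g -` (-{0}))"
      by (intro holomorphic_intros holomorphic_on_subset[OF f(1)] holomorphic_on_subset[OF g(1)]) auto
    hence "h holomorphic_on (g -` (-{0}))"
      by (rule holomorphic_transform) (auto simp: h_def)
    thus ?thesis
      using False by (intro holomorphic_on_imp_differentiable_at[OF _ op]) auto
  qed
  hence hol: "h holomorphic_on UNIV"
    by (simp add: field_differentiable_at_within holomorphic_on_def)

  have "bounded (range h)"
  proof (rule bounded_subset)
    \<comment> \<open>The image of the closed fundamental parallelogram; by periodicity it is the
      whole range of \<open>h\<close>.\<close>
    have "compact ((\<lambda>(a,b). h (of_real a + of_real b * \<tau>)) ` ({0..1} \<times> {0..1}))"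
      unfolding case_prod_unfold
      by (intro compact_continuous_image compact_Times
          continuous_on_compose2[OF holomorphic_on_imp_continuous_on[OF hol]] continuous_intros) auto
    thus "bounded ((\<lambda>(a,b). h (of_real a + of_real b * \<tau>)) ` ({0..1} \<times> {0..1}))"
      by (rule compact_imp_bounded)
    show "range h \<subseteq> (\<lambda>(a,b). h (of_real a + of_real b * \<tau>)) ` ({0..1} \<times> {0..1})"
    proof (rule image_subsetI)
      fix z :: complex
      define b where "b = Im z / Im \<tau>"
      define a where "a = Re z - b * Re \<tau>"
      have "z = of_real a + of_real b * \<tau>"
        using \<tau> by (auto simp: complex_eq_iff a_def b_def)
      also have "\<dots> = (of_real (frac a) + of_real (frac b) * \<tau>) + (of_int \<lfloor>a\<rfloor> + of_int \<lfloor>b\<rfloor> * \<tau>)"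
        by (simp add: frac_def algebra_simps)
      finally have "h z = h (of_real (frac a) + of_real (frac b) * \<tau>)"
        by (simp only: per)
      moreover have "frac a \<in> {0..1}" "frac b \<in> {0..1}"
        by (auto intro: less_imp_le frac_lt_1)
      ultimately show "h z \<in> (\<lambda>(a,b). h (of_real a + of_real b * \<tau>)) ` ({0..1} \<times> {0..1})"
        by (auto intro!: image_eqI[of _ _ "(frac a, frac b)"])
    qed
  qed
  with hol have "h constant_on UNIV" by (rule Liouville_theorem)
  hence "h u = h 0" by (auto simp: constant_on_def)
  thus ?thesis using u zero \<open>G \<noteq> 0\<close> by (simp add: h_def field_simps)
qed

section \<open>The nome and the theta product\<close>

lemma nome_add: "nome (x + y) = nome x * nome y"
  by (simp add: nome_def ring_distribs exp_add)

lemma nome_nonzero [simp]: "nome x \<noteq> 0"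
  by (simp add: nome_def)

lemma nome_0 [simp]: "nome 0 = 1"
  by (simp add: nome_def)

lemma nome_minus: "nome (-x) = 1 / nome x"
  by (simp add: nome_def exp_minus field_simps)

lemma nome_diff: "nome (x - y) = nome x / nome y"
  using nome_add[of x "-y"] by (simp add: nome_minus)

lemma nome_half [simp]: "nome (1 / 2) = -1"
  by (simp add: nome_def)

lemma nome_1 [simp]: "nome 1 = 1"
  using nome_add[of "1/2" "1/2"] by simp

lemma nome_of_nat_mult: "nome (of_nat n * x) = nome x ^ n"
  by (induction n) (simp_all add: ring_distribs nome_add)

lemma nome_of_int [simp]: "nome (of_int n) = 1"
proof (cases n)
  case (nonneg k)
  thus ?thesis using nome_of_nat_mult[of k 1] by simp
next
  case (neg k)
  hence "of_int n = - (of_nat (Suc k) * 1 :: complex)" by simp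
  thus ?thesis by (simp only: nome_minus nome_of_nat_mult nome_1) simp
qed

lemma nome_eq_1: "nome x = 1 \<Longrightarrow> \<exists>m::int. x = of_int m"
  using exp_eq[of "2 * of_real pi * \<i> * x" 0] by (auto simp: nome_def)

lemma norm_nome: "norm (nome x) = exp (- 2 * pi * Im x)"
  by (simp add: nome_def)

lemma norm_nome_less_1: "Im x > 0 \<Longrightarrow> norm (nome x) < 1"
  by (simp add: norm_nome)

lemma holomorphic_nome [holomorphic_intros]:
  "f holomorphic_on A \<Longrightarrow> (\<lambda>x. nome (f x)) holomorphic_on A"
  unfolding nome_def by (intro holomorphic_intros)

lemma ramanujan_L_eq:
  assumes "Im x > 0"
  shows "ramanujan_L x = nome x * qprod (nome x) (nome x) ^ 24"
proof -
  have "convergent_prod (\<lambda>n. 1 - nome x * nome x ^ n)"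
    using qprod_has_prod[OF norm_nome_less_1[OF assms]] has_prod_iff by blast
  from prodinf_power[OF this, of 24] show ?thesis
    by (simp add: ramanujan_L_def qprod_def)
qed

text \<open>With w = \<open>nome u\<close> this is (w;q)(q/w;q), in which u and
  \<open>\<tau>\<close> - u merely swap the two factors.\<close>

definition theta :: "complex \<Rightarrow> complex \<Rightarrow> complex" where
  "theta \<tau> u = qprod (nome u) (nome \<tau>) * qprod (nome (\<tau> - u)) (nome \<tau>)"

lemma holomorphic_theta [holomorphic_intros]:
  assumes "Im \<tau> > 0" "f holomorphic_on A"
  shows "(\<lambda>u. theta \<tau> (f u)) holomorphic_on A"
proof -
  note * = holomorphic_on_compose_gen[OF _ holomorphic_qprod[OF norm_nome_less_1[OF assms(1)]], unfolded o_def]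
  show ?thesis
    unfolding theta_def by (intro holomorphic_intros * assms) auto
qed

lemma theta_reflect: "theta \<tau> (\<tau> - u) = theta \<tau> u"
  by (simp add: theta_def)

lemma theta_add_1: "theta \<tau> (u + 1) = theta \<tau> u"
  by (simp add: theta_def nome_add nome_diff)

text \<open>Splitting off 1 - w isolates the zero at u = 0 and leaves a factor that is even in
  u.\<close>

lemma theta_unfold:
  assumes "Im \<tau> > 0"
  shows "theta \<tau> u = (1 - nome u) * (qprod (nome (\<tau> + u)) (nome \<tau>) * qprod (nome (\<tau> - u)) (nome \<tau>))"
  using qprod_rec[OF norm_nome_less_1[OF assms], of "nome u"]
  by (simp add: theta_def nome_add mult_ac)

lemma theta_minus:
  assumes "Im \<tau> > 0"
  shows "theta \<tau> (-u) = - nome (-u) * theta \<tau> u"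
  unfolding theta_unfold[OF assms] by (simp add: nome_minus field_simps)

lemma theta_add_period:
  assumes "Im \<tau> > 0"
  shows "theta \<tau> (u + \<tau>) = - nome (-u) * theta \<tau> u"
  using theta_reflect[of \<tau> "-u"] theta_minus[OF assms, of u] by (simp add: add_ac)

lemma theta_0: "Im \<tau> > 0 \<Longrightarrow> theta \<tau> 0 = 0"
  by (simp add: theta_unfold)

lemma theta_eq_0D:
  assumes "Im \<tau> > 0" "theta \<tau> u = 0"
  shows "\<exists>m n :: int. u = of_int m + of_int n * \<tau>"
proof -
  have "(\<exists>n. nome (u + of_nat n * \<tau>) = 1) \<or> (\<exists>n. nome (\<tau> - u + of_nat n * \<tau>) = 1)"
    using assms by (simp add: theta_def qprod_eq_0_iff norm_nome_less_1 nome_add nome_of_nat_mult)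
  then consider n and m :: int where "u + of_nat n * \<tau> = of_int m"
    | n and m :: int where "\<tau> - u + of_nat n * \<tau> = of_int m"
    using nome_eq_1 by blast
  thus ?thesis
  proof cases
    case 1
    hence "u = of_int m + of_int (- int n) * \<tau>" by (simp add: algebra_simps)
    thus ?thesis by blast
  next
    case 2
    hence "u = of_int (-m) + of_int (int n + 1) * \<tau>" by (simp add: algebra_simps)
    thus ?thesis by blast
  qed
qed

text \<open>At 0 only the derivative of 1 - \<open>nome u\<close> survives, multiplied by the
  remaining factor \<open>R 0\<close> = (q;q)^2. This is the link from theta to L.\<close>

lemma theta_has_derivative_0:
  assumes "Im \<tau> > 0"
  shows "(theta \<tau> has_field_derivative - 2 * of_real pi * \<i> * qprod (nome \<tau>) (nome \<tau>) ^ 2) (at 0)"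
proof -
  define R where "R u = qprod (nome (\<tau> + u)) (nome \<tau>) * qprod (nome (\<tau> - u)) (nome \<tau>)" for u
  note * = holomorphic_on_compose_gen[OF _ holomorphic_qprod[OF norm_nome_less_1[OF assms(1)]], unfolded o_def]
  have "R holomorphic_on UNIV"
    unfolding R_def by (intro holomorphic_intros *) auto
  then obtain R' where "(R has_field_derivative R') (at 0)"
    by (metis UNIV_I field_differentiable_def holomorphic_on_imp_differentiable_at open_UNIV)
  moreover have "((\<lambda>u. 1 - nome u) has_field_derivative - 2 * of_real pi * \<i>) (at 0)"
    unfolding nome_def by (auto intro!: derivative_eq_intros)
  ultimately have "((\<lambda>u. (1 - nome u) * R u) has_field_derivative
      - 2 * of_real pi * \<i> * R 0 + R' * (1 - nome 0)) (at 0)"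
    by (intro DERIV_mult)
  hence "((\<lambda>u. (1 - nome u) * R u) has_field_derivative
      - 2 * of_real pi * \<i> * qprod (nome \<tau>) (nome \<tau>) ^ 2) (at 0)"
    by (simp add: R_def power2_eq_square)
  thus ?thesis by (simp add: R_def flip: theta_unfold[OF assms])
qed

text \<open>With r = \<open>nome (\<tau> / 2)\<close> and q = r^2, the values are 2 (-q;q)^2,
  (r;q)^2 and (-r;q)^2, so their product is twice the square of Euler's identity. In particular,
  theta has no zero at these points.\<close>

lemma theta_half_periods:
  assumes "Im \<tau> > 0"
  shows "theta \<tau> (1 / 2) * theta \<tau> (\<tau> / 2) * theta \<tau> ((1 + \<tau>) / 2) = 2"
proof -
  define r where "r = nome (\<tau> / 2)"
  have r: "norm r < 1" using assms unfolding r_def by (intro norm_nome_less_1) simp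
  have q: "nome \<tau> = r\<^sup>2"
    using nome_add[of "\<tau> / 2" "\<tau> / 2"] by (simp add: r_def power2_eq_square)
  have q': "norm (r\<^sup>2) < 1" using norm_nome_less_1[OF assms] by (simp add: q)
  have "theta \<tau> (1 / 2) = 2 * qprod (-(r\<^sup>2)) (r\<^sup>2) ^ 2"
    using qprod_rec[OF q', of "-1"] by (simp add: theta_def nome_diff q power2_eq_square)
  moreover have "theta \<tau> (\<tau> / 2) = qprod r (r\<^sup>2) ^ 2"
    by (simp add: theta_def nome_diff q flip: r_def) (simp add: power2_eq_square)
  moreover have "theta \<tau> ((1 + \<tau>) / 2) = qprod (-r) (r\<^sup>2) ^ 2"
    by (simp add: theta_def nome_diff nome_add q add_divide_distrib flip: r_def) (simp add: power2_eq_square)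
  ultimately have "theta \<tau> (1 / 2) * theta \<tau> (\<tau> / 2) * theta \<tau> ((1 + \<tau>) / 2)
      = 2 * (qprod (-(r\<^sup>2)) (r\<^sup>2) * qprod r (r\<^sup>2) * qprod (-r) (r\<^sup>2)) ^ 2"
    by (simp add: power_mult_distrib)
  thus ?thesis using euler_qprod[OF r] by simp
qed

theorem ramanujan_L_inversion:
  assumes \<tau>: "Im \<tau> > 0"
  shows "ramanujan_L (-1 / \<tau>) = \<tau> ^ 12 * ramanujan_L \<tau>"
proof -
  have [simp]: "\<tau> \<noteq> 0" using \<tau> by auto
  define \<sigma> where "\<sigma> = -1 / \<tau>"
  have \<sigma>: "Im \<sigma> > 0"
    using \<tau> by (simp add: \<sigma>_def Im_divide sum_power2_gt_zero_iff)
  define P where "P = qprod (nome \<tau>) (nome \<tau>)"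
  define P' where "P' = qprod (nome \<sigma>) (nome \<sigma>)"
  have P: "P \<noteq> 0"
    unfolding P_def by (intro qprod_self_nonzero norm_nome_less_1 \<tau>)
  have \<sigma>\<tau>: "\<sigma> * \<tau> = -1" by (simp add: \<sigma>_def)
  \<comment> \<open>The quadratic exponent is fitted so that \<open>f\<close> gets the multipliers
    of \<open>theta \<tau>\<close>: the step u + 1 moves u/\<open>\<tau>\<close> by
    -\<open>\<sigma>\<close>, a quasi-period, while u + \<open>\<tau>\<close> moves it by the true
    period 1.\<close>
  define e where "e u = (u + u * \<sigma> + u\<^sup>2 * \<sigma>) / 2" for u
  define f where "f u = nome (e u) * theta \<sigma> (u / \<tau>)" for u
  define F where "F = - 2 * of_real pi * \<i> * P'\<^sup>2 / \<tau>"
  define G where "G = - 2 * of_real pi * \<i> * P\<^sup>2"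
  have e1: "e (u + 1) + (u + 1) / \<tau> = e u + 1 / 2" for u
  proof -
    have "(u + 1) / \<tau> = - ((u + 1) * \<sigma>)" by (simp add: \<sigma>_def)
    moreover have "e (u + 1) - (u + 1) * \<sigma> = e u + 1 / 2"
      by (simp add: e_def field_simps power2_eq_square)
    ultimately show ?thesis by simp
  qed
  have e\<tau>: "e (u + \<tau>) = e u - 1 / 2 - u" for u
  proof -
    have "e (u + \<tau>) = e u + (\<tau> + \<sigma> * \<tau> + 2 * u * (\<sigma> * \<tau>) + (\<sigma> * \<tau>) * \<tau>) / 2"
      by (simp add: e_def field_simps power2_eq_square)
    thus ?thesis by (simp add: \<sigma>\<tau> field_simps)
  qed
  have f1: "f (u + 1) = f u" for u
  proof -
    have "theta \<sigma> (u / \<tau>) = - nome (- ((u + 1) / \<tau>)) * theta \<sigma> ((u + 1) / \<tau>)"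
      using theta_add_period[OF \<sigma>, of "(u + 1) / \<tau>"] by (simp add: \<sigma>_def add_divide_distrib)
    hence "f u = - (nome (e u) / nome ((u + 1) / \<tau>)) * theta \<sigma> ((u + 1) / \<tau>)"
      by (simp add: f_def nome_minus)
    also have "e u = e (u + 1) + (u + 1) / \<tau> - 1 / 2"
      using e1[of u] by simp
    hence "nome (e u) / nome ((u + 1) / \<tau>) = - nome (e (u + 1))"
      by (simp only: nome_diff nome_add nome_half) simp
    finally show ?thesis by (simp add: f_def)
  qed
  have f\<tau>: "f (u + \<tau>) = - nome (- u) * f u" for u
    using theta_add_1[of \<sigma> "u / \<tau>"] by (simp add: f_def e\<tau> add_divide_distrib nome_diff nome_minus)
  have hol_f: "f holomorphic_on UNIV"
    unfolding f_def e_def by (intro holomorphic_intros \<sigma>) auto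
  have f': "(f has_field_derivative F) (at 0)"
  proof -
    have "((\<lambda>u. nome (e u)) holomorphic_on UNIV)"
      unfolding e_def by (intro holomorphic_intros) auto
    then obtain E' where "((\<lambda>u. nome (e u)) has_field_derivative E') (at 0)"
      by (metis UNIV_I field_differentiable_def holomorphic_on_imp_differentiable_at open_UNIV)
    moreover have "((\<lambda>u. theta \<sigma> (u / \<tau>)) has_field_derivative (- 2 * of_real pi * \<i> * P'\<^sup>2) * (1 / \<tau>)) (at 0)"
      by (rule DERIV_chain2[where f = "theta \<sigma>"])
        (auto intro!: derivative_eq_intros simp: P'_def theta_has_derivative_0[OF \<sigma>, simplified])
    ultimately show ?thesis
      unfolding f_def by (auto intro!: derivative_eq_intros simp: theta_0 \<sigma> F_def e_def)
  qed
  have key: "f u * G = F * theta \<tau> u" if "theta \<tau> u \<noteq> 0" for u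
  proof (rule quasi_elliptic_proportional[where f = f and g = "theta \<tau>" and \<mu> = "\<lambda>u. - nome (- u)", OF \<tau> hol_f f1 f\<tau> _ _ _ _ _ _ _ f' _ _ that])
    show "theta \<tau> holomorphic_on UNIV" using holomorphic_theta[OF \<tau>, of "\<lambda>u. u"] by simp
    show "(theta \<tau> has_field_derivative G) (at 0)"
      unfolding G_def P_def by (rule theta_has_derivative_0[OF \<tau>])
  qed (use \<tau> \<sigma> P in \<open>auto simp: theta_add_1 theta_add_period theta_0 G_def f_def dest: theta_eq_0D\<close>)

  have nz: "theta \<tau> (1 / 2) \<noteq> 0" "theta \<tau> (\<tau> / 2) \<noteq> 0" "theta \<tau> ((1 + \<tau>) / 2) \<noteq> 0"
    using theta_half_periods[OF \<tau>] by auto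
  \<comment> \<open>Division by \<open>\<tau>\<close> permutes the half-periods: 1/2,
    \<open>\<tau>\<close>/2 and (1 + \<open>\<tau>\<close>)/2 go to -\<open>\<sigma>\<close>/2, 1/2
    and 1 - (1 + \<open>\<sigma>\<close>)/2. \<open>E\<close> collects the values of
    \<open>nome (e u)\<close> and the factors from reflecting the first and third points; the two
    minus signs cancel.\<close>
  define E where "E = nome (e (1 / 2)) * nome (e (\<tau> / 2)) * nome (e ((1 + \<tau>) / 2))
                        * nome (- \<sigma> / 2) * nome (- (1 + \<sigma>) / 2)"
  have "f (1 / 2) = - (nome (e (1 / 2)) * nome (- \<sigma> / 2)) * theta \<sigma> (\<sigma> / 2)"
  proof -
    have *: "1 / 2 / \<tau> = - (\<sigma> / 2)" by (simp add: \<sigma>_def)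
    show ?thesis unfolding f_def * theta_minus[OF \<sigma>] by simp
  qed
  moreover have "f (\<tau> / 2) = nome (e (\<tau> / 2)) * theta \<sigma> (1 / 2)"
    by (simp add: f_def)
  moreover have "f ((1 + \<tau>) / 2) = - (nome (e ((1 + \<tau>) / 2)) * nome (- (1 + \<sigma>) / 2)) * theta \<sigma> ((1 + \<sigma>) / 2)"
  proof -
    have "(1 + \<tau>) / 2 / \<tau> = - ((1 + \<sigma>) / 2) + 1"
      by (simp add: \<sigma>_def field_simps)
    hence *: "theta \<sigma> ((1 + \<tau>) / 2 / \<tau>) = - nome (- ((1 + \<sigma>) / 2)) * theta \<sigma> ((1 + \<sigma>) / 2)"
      by (simp only: theta_add_1 theta_minus[OF \<sigma>])
    have "- (1 + \<sigma>) / 2 = - ((1 + \<sigma>) / 2)" by (rule minus_divide_left [symmetric])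
    thus ?thesis unfolding f_def * by (simp only: mult.assoc mult_minus_left mult_minus_right)
  qed
  ultimately have "f (1 / 2) * f (\<tau> / 2) * f ((1 + \<tau>) / 2)
      = E * (theta \<sigma> (1 / 2) * theta \<sigma> (\<sigma> / 2) * theta \<sigma> ((1 + \<sigma>) / 2))"
    by (simp add: E_def)
  also have "\<dots> = 2 * E" using theta_half_periods[OF \<sigma>] by simp
  finally have "2 * E * G ^ 3 = (f (1 / 2) * G) * (f (\<tau> / 2) * G) * (f ((1 + \<tau>) / 2) * G)"
    by (simp add: power3_eq_cube mult_ac)
  also have "\<dots> = F ^ 3 * (theta \<tau> (1 / 2) * theta \<tau> (\<tau> / 2) * theta \<tau> ((1 + \<tau>) / 2))"
    unfolding key[OF nz(1)] key[OF nz(2)] key[OF nz(3)] by (simp add: power3_eq_cube mult_ac)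
  also have "\<dots> = 2 * F ^ 3" using theta_half_periods[OF \<tau>] by simp
  finally have "E * G ^ 3 = F ^ 3" by simp
  moreover have "F = (- 2 * of_real pi * \<i>) * (P'\<^sup>2 / \<tau>)" "G = (- 2 * of_real pi * \<i>) * P\<^sup>2"
    by (simp_all add: F_def G_def)
  ultimately have "(- 2 * of_real pi * \<i>) ^ 3 * (E * (P\<^sup>2) ^ 3) = (- 2 * of_real pi * \<i>) ^ 3 * (P'\<^sup>2 / \<tau>) ^ 3"
    by (simp only: power_mult_distrib mult_ac)
  hence "E * (P\<^sup>2) ^ 3 = (P'\<^sup>2 / \<tau>) ^ 3"
    by (subst (asm) mult_cancel_left) simp
  \<comment> \<open>The fourth power turns P^6 into P^24 and \<open>\<tau>\<close>^3 into
    \<open>\<tau>\<close>^12, and makes the constant in the exponent of \<open>E\<close> an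
    integer.\<close>
  hence "(E * (P\<^sup>2) ^ 3) ^ 4 = ((P'\<^sup>2 / \<tau>) ^ 3) ^ 4" by simp
  hence main: "E ^ 4 * P ^ 24 * \<tau> ^ 12 = P' ^ 24"
    by (simp add: power_mult_distrib power_divide flip: power_mult)
  have "E ^ 4 = nome (4 * (e (1 / 2) + e (\<tau> / 2) + e ((1 + \<tau>) / 2) + (- \<sigma> / 2) + (- (1 + \<sigma>) / 2)))"
    using nome_of_nat_mult[of 4] unfolding E_def nome_add[symmetric] by (simp only: of_nat_numeral)
  also have "4 * (e (1 / 2) + e (\<tau> / 2) + e ((1 + \<tau>) / 2) + (- \<sigma> / 2) + (- (1 + \<sigma>) / 2))
      = \<tau> - \<sigma> - of_int 3"
  proof -
    have "e (1 / 2) = 1 / 4 + 3 / 8 * \<sigma>"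
      by (simp add: e_def field_simps power2_eq_square)
    moreover have "e (\<tau> / 2) = (\<tau> / 2 + \<sigma> * \<tau> / 2 + (\<sigma> * \<tau>) * \<tau> / 4) / 2"
      by (simp add: e_def field_simps power2_eq_square)
    hence "e (\<tau> / 2) = \<tau> / 8 - 1 / 4"
      unfolding \<sigma>\<tau> by (rule trans) (simp add: field_simps)
    moreover have "e ((1 + \<tau>) / 2) = (\<tau> / 2 + 1 / 2 + 3 / 4 * \<sigma> + (\<sigma> * \<tau>) + (\<sigma> * \<tau>) * \<tau> / 4) / 2"
      by (simp add: e_def field_simps power2_eq_square)
    hence "e ((1 + \<tau>) / 2) = \<tau> / 8 + 3 / 8 * \<sigma> - 1 / 4"
      unfolding \<sigma>\<tau> by (rule trans) (simp add: field_simps)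
    ultimately show ?thesis by (simp only:) (simp add: field_simps)
  qed
  finally have "E ^ 4 * nome \<sigma> = nome \<tau>"
    by (simp only: nome_diff nome_of_int) simp
  hence "nome \<sigma> * P' ^ 24 = \<tau> ^ 12 * (nome \<tau> * P ^ 24)"
    by (simp flip: main add: mult_ac)
  thus ?thesis
    using ramanujan_L_eq[OF \<tau>] ramanujan_L_eq[OF \<sigma>] by (simp add: P_def P'_def \<sigma>_def)
qed

section \<open>Growth of the coefficients\<close>

lemma power_times_exp_bounded:
  fixes c :: real
  assumes "c > 0"
  obtains C where "C > 0" "\<And>t. t \<ge> 0 \<Longrightarrow> t ^ k * exp (- c * t) \<le> C"
proof
  \<comment> \<open>Chosen so that k/b <= c when x <= exp x is raised to the k-th power at x = t/b;
    the added 1 keeps \<open>b\<close> positive for k = 0.\<close>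
  define b where "b = (real k + 1) / c"
  have b: "b > 0" using assms by (simp add: b_def add_nonneg_pos)
  thus "b ^ k > 0" by simp
  fix t :: real assume t: "t \<ge> 0"
  have "t = b * (t / b)" using b by simp
  also have "t / b \<le> exp (t / b)" using exp_ge_add_one_self[of "t / b"] by linarith
  finally have "t \<le> b * exp (t / b)" using b by (simp add: mult_left_mono)
  hence "t ^ k \<le> b ^ k * exp (t / b) ^ k" using t by (metis power_mono power_mult_distrib)
  also have "exp (t / b) ^ k = exp (real k * (t / b))" by (rule exp_of_nat_mult[symmetric])
  also have "real k * (t / b) \<le> c * t"
  proof -
    have "real k / b \<le> c" using assms by (simp add: b_def field_simps)
    from mult_right_mono[OF this t] show ?thesis by (simp add: field_simps)
  qed
  finally have "t ^ k \<le> b ^ k * exp (c * t)" using b by simp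
  thus "t ^ k * exp (- c * t) \<le> b ^ k" by (simp add: exp_minus field_simps)
qed

lemma ramanujan_L_add_of_int: "ramanujan_L (z + of_int n) = ramanujan_L z"
  by (simp add: ramanujan_L_def nome_add)

text \<open>For Im z >= 1/2 the nome stays in the disc of radius exp(-pi), a compact part of the
  unit disc, where Euler's function is bounded. The factor \<open>nome z\<close> supplies the
  exponential decay.\<close>

lemma ramanujan_L_exp_bound:
  obtains M where "M > 0" "\<And>z. Im z \<ge> 1 / 2 \<Longrightarrow> norm (ramanujan_L z) \<le> M * exp (- 2 * pi * Im z)"
proof -
  have pi_exp: "exp (-pi) < 1" by simp
  have "bounded ((\<lambda>q. qprod q q) ` cball 0 (exp (-pi)))"
    by (intro compact_imp_bounded compact_continuous_image compact_cball continuous_on_subset[OF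
          holomorphic_on_imp_continuous_on[OF holomorphic_qprod_self]])
      (auto intro: le_less_trans[OF _ pi_exp])
  then obtain B where "\<forall>q\<in>cball 0 (exp (-pi)). norm (qprod q q) \<le> B"
    by (auto simp: bounded_iff)
  hence B: "norm (qprod q q) \<le> B" if "norm q \<le> exp (-pi)" for q
    using that by simp
  have "B \<ge> 0" using B[of 0] norm_ge_zero[of "qprod 0 0"] by (simp del: norm_ge_zero)
  show thesis
  proof (rule that[of "B ^ 24 + 1"])
    show "B ^ 24 + 1 > 0" using \<open>B \<ge> 0\<close> by (simp add: add_nonneg_pos)
    fix z :: complex assume z: "Im z \<ge> 1 / 2"
    hence "norm (nome z) \<le> exp (-pi)" by (simp add: norm_nome)
    from B[OF this] have "norm (qprod (nome z) (nome z)) ^ 24 \<le> B ^ 24"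
      by (intro power_mono) auto
    hence "norm (ramanujan_L z) \<le> exp (- 2 * pi * Im z) * (B ^ 24 + 1)"
      using z by (subst ramanujan_L_eq) (auto simp: norm_mult norm_power norm_nome)
    thus "norm (ramanujan_L z) \<le> (B ^ 24 + 1) * exp (- 2 * pi * Im z)"
      by (simp add: mult.commute)
  qed
qed

text \<open>The function |L(z)| (Im z)^6 is invariant under z + 1 and -1/z. The bound is immediate
  for Im z >= 1/2; below that line, a translation followed by an inversion at least doubles the
  imaginary part. The induction counts the doublings still required to reach 1/2.\<close>

lemma ramanujan_L_bound:
  obtains C where "C > 0" "\<And>z. Im z > 0 \<Longrightarrow> norm (ramanujan_L z) * Im z ^ 6 \<le> C"
proof -
  from ramanujan_L_exp_bound obtain M where
    M: "M > 0" "\<And>z. Im z \<ge> 1 / 2 \<Longrightarrow> norm (ramanujan_L z) \<le> M * exp (- 2 * pi * Im z)" by blast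
  from power_times_exp_bounded[of "2 * pi" 6] obtain B where
    B: "B > 0" "\<And>t. t \<ge> 0 \<Longrightarrow> t ^ 6 * exp (- (2 * pi) * t) \<le> B" by auto
  have base: "norm (ramanujan_L z) * Im z ^ 6 \<le> M * B" if z: "Im z \<ge> 1 / 2" for z
  proof -
    have "norm (ramanujan_L z) * Im z ^ 6 \<le> M * exp (- 2 * pi * Im z) * Im z ^ 6"
      by (intro mult_right_mono M z) (use z in auto)
    also have "\<dots> = M * (Im z ^ 6 * exp (- (2 * pi) * Im z))" by simp
    also have "\<dots> \<le> M * B" using B(2)[of "Im z"] z M(1) by (intro mult_left_mono) auto
    finally show ?thesis .
  qed
  have "norm (ramanujan_L z) * Im z ^ 6 \<le> M * B" if "Im z > 0" "Im z * 2 ^ n \<ge> 1 / 2" for n z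
    using that
  proof (induction n arbitrary: z)
    case 0
    thus ?case using base[of z] by simp
  next
    case (Suc n)
    show ?case
    proof (cases "Im z \<ge> 1 / 2")
      case True
      thus ?thesis by (rule base)
    next
      case False
      define w where "w = z + of_int (- round (Re z))"
      have Lw: "ramanujan_L w = ramanujan_L z" unfolding w_def by (rule ramanujan_L_add_of_int)
      have Im_w: "Im w = Im z" by (simp add: w_def)
      have "\<bar>Re w\<bar> \<le> 1 / 2"
        using of_int_round_abs_le[of "Re z"] by (simp add: w_def abs_minus_commute)
      hence "(Re w)\<^sup>2 \<le> (1 / 2)\<^sup>2" using power_mono[of "\<bar>Re w\<bar>" "1 / 2" 2] by simp
      moreover have "(Im w)\<^sup>2 \<le> (1 / 2)\<^sup>2"
        using False Suc.prems by (intro power_mono) (auto simp: Im_w)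
      \<comment> \<open>Both coordinates are at most 1/2 in modulus, so |w|^2 <= 1/2, and Im(-1/w) =
        Im w / |w|^2 is at least 2 Im w.\<close>
      ultimately have norm_w: "(norm w)\<^sup>2 \<le> 1 / 2"
        unfolding cmod_power2 by (simp add: power2_eq_square)
      have w0: "w \<noteq> 0" using Suc.prems Im_w by auto
      hence nw: "norm w > 0" by simp
      define v where "v = -1 / w"
      have Im_v: "Im v = Im w / (norm w)\<^sup>2"
        by (simp add: v_def Im_divide cmod_power2)
      have "2 * Im w \<le> Im v"
      proof -
        have "2 * Im w * (norm w)\<^sup>2 \<le> 2 * Im w * (1 / 2)"
          using norm_w Suc.prems Im_w by (intro mult_left_mono) auto
        thus ?thesis using nw by (simp add: Im_v field_simps)
      qed
      hence "2 * Im w * 2 ^ n \<le> Im v * 2 ^ n" by (rule mult_right_mono) simp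
      moreover have "2 * Im w * 2 ^ n = Im z * 2 ^ Suc n" by (simp add: Im_w)
      ultimately have "Im v * 2 ^ n \<ge> 1 / 2" using Suc.prems by linarith
      moreover have "Im v > 0" using Suc.prems nw by (simp add: Im_v Im_w)
      ultimately have "norm (ramanujan_L v) * Im v ^ 6 \<le> M * B" by (intro Suc.IH)
      moreover have "ramanujan_L v = w ^ 12 * ramanujan_L w"
        unfolding v_def using Suc.prems Im_w by (intro ramanujan_L_inversion) simp
      ultimately show ?thesis using w0
        by (simp add: Im_v Lw Im_w norm_mult norm_power power_divide flip: power_mult)
    qed
  qed
  moreover have "\<exists>n. Im z * 2 ^ n \<ge> 1 / 2" if "Im z > 0" for z
  proof -
    obtain n where "1 / (2 * Im z) < 2 ^ n"
      using real_arch_pow[of 2 "1 / (2 * Im z)"] by auto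
    thus ?thesis using that by (intro exI[of _ n]) (simp add: field_simps)
  qed
  ultimately show thesis
    using that[of "M * B"] M(1) B(1) by (meson mult_pos_pos)
qed

section \<open>Mean squares of the coefficients\<close>

lemma parseval_roots_of_unity:
  fixes b :: "nat \<Rightarrow> complex"
  assumes "M > 0"
  defines "\<zeta> \<equiv> \<lambda>n. cis (2 * pi * real n / real M)"
  shows "(\<Sum>k<M. norm (\<Sum>n<M. b n * \<zeta> k ^ n) ^ 2) = real M * (\<Sum>n<M. norm (b n) ^ 2)"
proof -
  \<comment> \<open>The symmetry in k and n turns the sum over the sample points k into a geometric
    sum, which gives orthogonality.\<close>
  have swap: "\<zeta> k ^ n = \<zeta> n ^ k" for k n
    unfolding \<zeta>_def Complex.DeMoivre by (rule arg_cong[where f = cis]) simp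
  have inj: "inj_on \<zeta> {..<M}"
    using Complex.bij_betw_roots_unity[OF assms(1)] by (simp add: \<zeta>_def bij_betw_def)
  have unit: "\<zeta> n * cnj (\<zeta> n) = 1" for n
    by (simp add: \<zeta>_def cis_cnj cis_mult)
  have orth: "(\<Sum>k<M. (\<zeta> n * cnj (\<zeta> m)) ^ k) = (if n = m then of_nat M else 0)" if "n < M" "m < M" for n m
  proof (cases "n = m")
    case False
    have "\<zeta> n * cnj (\<zeta> m) \<noteq> 1"
    proof
      assume *: "\<zeta> n * cnj (\<zeta> m) = 1"
      have "\<zeta> n = \<zeta> n * (cnj (\<zeta> m) * \<zeta> m)" using unit[of m] by (simp add: mult.commute)
      also have "\<dots> = \<zeta> m" using * by (simp flip: mult.assoc)
      finally show False using inj that False by (auto dest: inj_onD)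
    qed
    moreover have "\<zeta> j ^ M = 1" for j
    proof -
      have "\<zeta> j ^ M = cis (2 * pi * real j)"
        unfolding \<zeta>_def Complex.DeMoivre using assms(1) by (intro arg_cong[where f = cis]) simp
      thus ?thesis by (simp add: cis_multiple_2pi)
    qed
    hence "(\<zeta> n * cnj (\<zeta> m)) ^ M = 1"
      by (simp add: power_mult_distrib flip: complex_cnj_power)
    ultimately show ?thesis using False by (simp add: sum_gp_strict)
  qed (simp add: unit)
  have "complex_of_real (\<Sum>k<M. norm (\<Sum>n<M. b n * \<zeta> k ^ n) ^ 2)
      = (\<Sum>k<M. (\<Sum>n<M. b n * \<zeta> k ^ n) * cnj (\<Sum>n<M. b n * \<zeta> k ^ n))"
    by (simp only: of_real_sum complex_norm_square)
  also have "\<dots> = (\<Sum>k<M. (\<Sum>n<M. b n * \<zeta> n ^ k) * cnj (\<Sum>n<M. b n * \<zeta> n ^ k))"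
  proof -
    have "(\<Sum>n<M. b n * \<zeta> k ^ n) = (\<Sum>n<M. b n * \<zeta> n ^ k)" for k
      by (intro sum.cong refl arg_cong2[where f = "(*)"] swap)
    thus ?thesis by simp
  qed
  also have "\<dots> = (\<Sum>k<M. \<Sum>n<M. \<Sum>m<M. b n * cnj (b m) * (\<zeta> n * cnj (\<zeta> m)) ^ k)"
    by (simp add: sum_product power_mult_distrib mult_ac)
  also have "\<dots> = (\<Sum>n<M. \<Sum>k<M. \<Sum>m<M. b n * cnj (b m) * (\<zeta> n * cnj (\<zeta> m)) ^ k)"
    by (rule sum.swap)
  also have "\<dots> = (\<Sum>n<M. \<Sum>m<M. \<Sum>k<M. b n * cnj (b m) * (\<zeta> n * cnj (\<zeta> m)) ^ k)"
    by (intro sum.cong refl sum.swap)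
  also have "\<dots> = (\<Sum>n<M. \<Sum>m<M. b n * cnj (b m) * (if n = m then of_nat M else 0))"
    by (simp add: orth flip: sum_distrib_left)
  also have "\<dots> = (\<Sum>n<M. b n * cnj (b n) * of_nat M)"
    by (intro sum.cong refl) (simp add: if_distrib cong: if_cong)
  also have "\<dots> = complex_of_real (real M * (\<Sum>n<M. norm (b n) ^ 2))"
    by (simp add: complex_norm_square sum_distrib_left mult_ac del: of_real_power)
  finally show ?thesis by (simp only: of_real_eq_iff)
qed

text \<open>Parseval on the circle |z| = r, with the integral replaced by an average over M-th roots
  of unity. M is also the truncation length, so discrete orthogonality is exact; uniform convergence
  on the disc makes the truncation error less than \<open>\<epsilon>\<close>, which is removed at
  the end.\<close>

lemma powser_mean_square_le:
  fixes a :: "nat \<Rightarrow> complex"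
  assumes r: "r \<ge> 0" "ereal r < conv_radius a"
    and B: "\<And>z. norm z = r \<Longrightarrow> norm (\<Sum>n. a n * z ^ n) \<le> B"
  shows "(\<Sum>n<N. norm (a n) ^ 2 * r ^ (2 * n)) \<le> B\<^sup>2"
proof -
  have "B \<ge> 0" using B[of "of_real r"] r(1) norm_ge_zero order_trans by (metis abs_of_nonneg norm_of_real)
  have "sqrt (\<Sum>n<N. norm (a n) ^ 2 * r ^ (2 * n)) \<le> B + \<epsilon>" if \<epsilon>: "\<epsilon> > 0" for \<epsilon>
  proof -
    have "\<forall>\<^sub>F M in sequentially. \<forall>z\<in>cball 0 r. dist (\<Sum>n<M. a n * (z - 0) ^ n) (\<Sum>n. a n * (z - 0) ^ n) < \<epsilon>"
      using powser_uniform_limit[OF r(2), of 0] \<epsilon> by (simp add: uniform_limit_iff)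
    \<comment> \<open>\<open>Suc N\<close> ensures both that M is positive and that the first N
      coefficients are included.\<close>
    hence "\<forall>\<^sub>F M in sequentially. M \<ge> Suc N \<and> (\<forall>z\<in>cball 0 r. dist (\<Sum>n<M. a n * z ^ n) (\<Sum>n. a n * z ^ n) < \<epsilon>)"
      using eventually_ge_at_top[of "Suc N"] by eventually_elim simp
    then obtain M where M: "M \<ge> Suc N"
      "\<And>z. norm z \<le> r \<Longrightarrow> dist (\<Sum>n<M. a n * z ^ n) (\<Sum>n. a n * z ^ n) < \<epsilon>"
      by (auto simp: eventually_sequentially)
    define \<zeta> where "\<zeta> n = cis (2 * pi * real n / real M)" for n
    have le: "norm (\<Sum>n<M. (a n * of_real r ^ n) * \<zeta> k ^ n) \<le> B + \<epsilon>" for k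
    proof -
      define z where "z = of_real r * \<zeta> k"
      have z: "norm z = r" using r(1) by (simp add: z_def \<zeta>_def norm_mult)
      have "(\<Sum>n<M. (a n * of_real r ^ n) * \<zeta> k ^ n) = (\<Sum>n<M. a n * z ^ n)"
        by (simp add: z_def power_mult_distrib mult_ac)
      also have "norm \<dots> \<le> norm (\<Sum>n. a n * z ^ n) + \<epsilon>"
        using M(2)[of z] z norm_triangle_sub[of "\<Sum>n<M. a n * z ^ n" "\<Sum>n. a n * z ^ n"]
        by (simp add: dist_norm)
      also have "norm (\<Sum>n. a n * z ^ n) \<le> B" by (rule B[OF z])
      finally show ?thesis by simp
    qed
    have "real M * (\<Sum>n<M. norm (a n * of_real r ^ n) ^ 2) =
        (\<Sum>k<M. norm (\<Sum>n<M. (a n * of_real r ^ n) * \<zeta> k ^ n) ^ 2)"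
      using parseval_roots_of_unity[of M "\<lambda>n. a n * of_real r ^ n"] M(1) by (simp add: \<zeta>_def)
    also have "\<dots> \<le> (\<Sum>k<M. (B + \<epsilon>)\<^sup>2)"
      by (intro sum_mono power_mono le) auto
    also have "\<dots> = real M * (B + \<epsilon>)\<^sup>2" by simp
    finally have "(\<Sum>n<M. norm (a n * of_real r ^ n) ^ 2) \<le> (B + \<epsilon>)\<^sup>2"
      using M(1) by simp
    moreover have "(\<Sum>n<N. norm (a n) ^ 2 * r ^ (2 * n)) \<le> (\<Sum>n<M. norm (a n * of_real r ^ n) ^ 2)"
    proof -
      have eq: "norm (a n) ^ 2 * r ^ (2 * n) = norm (a n * of_real r ^ n) ^ 2" for n
        using r(1) by (simp add: norm_mult norm_power power_mult_distrib mult_ac flip: power_mult)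
      show ?thesis unfolding eq by (rule sum_mono2) (use M(1) in auto)
    qed
    ultimately show ?thesis
      using \<open>B \<ge> 0\<close> \<epsilon> by (intro real_le_lsqrt) auto
  qed
  hence "sqrt (\<Sum>n<N. norm (a n) ^ 2 * r ^ (2 * n)) \<le> B" by (rule field_le_epsilon)
  thus ?thesis using sqrt_le_D by blast
qed

section \<open>The coefficients tau(n) and convergence of their Dirichlet series\<close>

lemma nome_surj:
  assumes "q \<noteq> 0" "norm q < 1"
  obtains x where "Im x > 0" "nome x = q"
proof -
  define x where "x = Ln q / (2 * of_real pi * \<i>)"
  have x: "nome x = q" using assms by (simp add: x_def nome_def)
  hence "exp (- 2 * pi * Im x) < 1" using assms norm_nome[of x] by simp
  hence "Im x > 0" by (simp add: zero_less_mult_iff)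
  with x that show ?thesis by blast
qed

text \<open>Existence comes from the Taylor coefficients of q (q;q)^24 at 0, uniqueness from the
  identity theorem for power series in q, since the nome takes every value of the punctured unit
  disc.\<close>

lemma ramanujan_tau:
  shows ramanujan_tau_0: "ramanujan_tau 0 = 0"
    and ramanujan_tau_sums: "norm q < 1 \<Longrightarrow> (\<lambda>n. ramanujan_tau n * q ^ n) sums (q * qprod q q ^ 24)"
proof -
  define f where "f q = q * qprod q q ^ 24" for q :: complex
  have hol: "f holomorphic_on ball 0 1"
    unfolding f_def by (intro holomorphic_intros holomorphic_qprod_self)
  define t where "t n = (deriv ^^ n) f 0 / fact n" for n
  have t: "(\<lambda>n. t n * q ^ n) sums f q" if "norm q < 1" for q
    using holomorphic_power_series[OF hol, of q] that by (simp add: t_def)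
  have t0: "t 0 = 0" by (simp add: t_def f_def)
  have eq: "ramanujan_tau = t"
    unfolding ramanujan_tau_def
  proof (rule the_equality)
    have "(\<lambda>m. t (Suc m) * nome x ^ Suc m) sums ramanujan_L x" if "Im x > 0" for x
      using t[OF norm_nome_less_1[OF that]] t0
      by (subst sums_Suc_iff[of "\<lambda>n. t n * nome x ^ n"]) (simp add: ramanujan_L_eq that f_def)
    thus "t 0 = 0 \<and> (\<forall>x. Im x > 0 \<longrightarrow> (\<lambda>m. t (Suc m) * nome x ^ Suc m) sums ramanujan_L x)"
      using t0 by blast
  next
    fix t' assume t': "t' 0 = 0 \<and> (\<forall>x. Im x > 0 \<longrightarrow> (\<lambda>m. t' (Suc m) * nome x ^ Suc m) sums ramanujan_L x)"
    have t's: "(\<lambda>n. t' n * q ^ n) sums f q" if q: "norm q < 1" for q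
    proof (cases "q = 0")
      \<comment> \<open>The point q = 0 is no value of the nome; here the sum is the constant term,
        which the definition fixes to be 0.\<close>
      case True
      thus ?thesis using t' powser_sums_zero[of t'] by (simp add: f_def)
    next
      case False
      with q obtain x where x: "Im x > 0" "nome x = q" using nome_surj by blast
      hence "(\<lambda>m. t' (Suc m) * q ^ Suc m) sums f q"
        using t' ramanujan_L_eq[OF x(1)] by (auto simp: f_def)
      thus ?thesis
        using t' by (subst (asm) sums_Suc_iff[of "\<lambda>n. t' n * q ^ n"]) simp
    qed
    show "t' = t"
    proof (rule ccontr)
      assume "t' \<noteq> t"
      then obtain m where m: "t' m - t m \<noteq> 0" by force
      have d: "(\<lambda>n. (t' n - t n) * (q - 0) ^ n) sums 0" if "norm (q - 0) < 1" for q
        using sums_diff[OF t's t, of q q] that by (simp add: algebra_simps)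
      have "m > 0" using m t' t0 by (cases m) auto
      \<comment> \<open>Applied to the zero function: a nonzero coefficient of positive index would
        make the constant 0 nonzero on a punctured disc.\<close>
      from powser_0_nonzero[OF zero_less_one d _ m this] obtain s :: real
        where s: "s > 0" "\<And>z. z \<in> cball (0::complex) s - {0} \<Longrightarrow> (0::complex) \<noteq> 0"
        by blast
      show False using s(1) s(2)[of "of_real s"] by simp
    qed
  qed
  show "ramanujan_tau 0 = 0" by (simp add: eq t0)
  show "(\<lambda>n. ramanujan_tau n * q ^ n) sums (q * qprod q q ^ 24)" if "norm q < 1"
    using t[OF that] by (simp add: eq f_def)
qed

lemma ramanujan_L_sums:
  assumes "Im x > 0"
  shows "(\<lambda>n. ramanujan_tau n * nome x ^ n) sums ramanujan_L x"
  using ramanujan_tau_sums[OF norm_nome_less_1[OF assms]] ramanujan_L_eq[OF assms] by simp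

lemma ramanujan_tau_mean_square:
  obtains C where "\<And>N. N > 0 \<Longrightarrow> (\<Sum>n=1..N. norm (ramanujan_tau n) ^ 2) \<le> C * real N ^ 12"
proof -
  obtain C where C: "C > 0" "\<And>z. Im z > 0 \<Longrightarrow> norm (ramanujan_L z) * Im z ^ 6 \<le> C"
    using ramanujan_L_bound by blast
  have rad: "conv_radius ramanujan_tau \<ge> ereal 1"
    using ramanujan_tau_sums
    by (subst le_conv_radius_iff[where \<xi> = 0]) (auto simp: sums_iff)
  have "(\<Sum>n=1..N. norm (ramanujan_tau n) ^ 2) \<le> (C\<^sup>2 * exp (4 * pi)) * real N ^ 12" if N: "N > 0" for N
  proof -
    \<comment> \<open>The modulus of the nome on Im x = 1/N. There |L| <= C N^6, while the weights
      r^(2n) stay above exp(-4 pi) for n <= N and can be removed at the cost of a constant.\<close>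
    define r where "r = exp (- 2 * pi / real N)"
    have r: "r > 0" "r < 1" using N by (simp_all add: r_def)
    have "(\<Sum>n<Suc N. norm (ramanujan_tau n) ^ 2 * r ^ (2 * n)) \<le> (C * real N ^ 6)\<^sup>2"
    proof (rule powser_mean_square_le)
      show "ereal r < conv_radius ramanujan_tau"
        using r rad less_le_trans[of "ereal r" "ereal 1"] by simp
      fix z :: complex assume z: "norm z = r"
      with r have "z \<noteq> 0" "norm z < 1" by auto
      then obtain x where x: "Im x > 0" "nome x = z" by (rule nome_surj)
      hence Im_x: "Im x = 1 / real N"
        using z norm_nome[of x] N by (simp add: r_def field_simps)
      have "norm (ramanujan_L x) \<le> C * real N ^ 6"
        using C(2)[OF x(1)] N by (simp add: Im_x power_divide pos_divide_le_eq)
      thus "norm (\<Sum>n. ramanujan_tau n * z ^ n) \<le> C * real N ^ 6"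
        using ramanujan_L_sums[OF x(1)] x(2) by (simp add: sums_iff)
    qed (use r in auto)
    also have "(C * real N ^ 6)\<^sup>2 = C\<^sup>2 * real N ^ 12"
      by (simp add: power_mult_distrib flip: power_mult)
    finally have A: "(\<Sum>n<Suc N. norm (ramanujan_tau n) ^ 2 * r ^ (2 * n)) \<le> C\<^sup>2 * real N ^ 12" .
    have "(\<Sum>n=1..N. norm (ramanujan_tau n) ^ 2) * exp (- 4 * pi)
        = (\<Sum>n=1..N. norm (ramanujan_tau n) ^ 2 * exp (- 4 * pi))"
      by (rule sum_distrib_right)
    also have "\<dots> \<le> (\<Sum>n=1..N. norm (ramanujan_tau n) ^ 2 * r ^ (2 * n))"
    proof (intro sum_mono mult_left_mono)
      fix n assume n: "n \<in> {1..N}"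
      have "r ^ (2 * n) = exp (real (2 * n) * (- 2 * pi / real N))"
        unfolding r_def by (rule exp_of_nat_mult[symmetric])
      moreover have "- 4 * pi * 1 \<le> - 4 * pi * (real n / real N)"
        using n N by (intro mult_left_mono_neg) auto
      ultimately show "exp (- 4 * pi) \<le> r ^ (2 * n)" by (simp add: mult_ac)
    qed auto
    also have "\<dots> \<le> (\<Sum>n<Suc N. norm (ramanujan_tau n) ^ 2 * r ^ (2 * n))"
      using r by (intro sum_mono2) auto
    also note A
    finally show ?thesis by (simp add: exp_minus field_simps)
  qed
  thus thesis by (rule that)
qed

text \<open>A lacunary form of partial summation: \<open>n\<^sup>-\<^sup>s\<close> is dominated by the sum of \<open>(2\<^sup>j)\<^sup>-\<^sup>s\<close>
  over those \<open>j\<close> with \<open>n \<le> 2\<^sup>j\<close>.\<close>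

lemma summable_powr_of_partial_sums:
  fixes a :: "nat \<Rightarrow> real"
  assumes a: "\<And>n. a n \<ge> 0"
    and C: "\<And>N. N > 0 \<Longrightarrow> (\<Sum>n=1..N. a n) \<le> C * real N powr p"
    and s: "s > p" "s \<ge> 0"
  shows "summable (\<lambda>n. a n * real n powr (-s))"
proof -
  \<comment> \<open>The dyadic block j contributes at most a constant times 2^(jp) 2^(-js), the j-th
    power of this ratio.\<close>
  define c where "c = 2 powr (p - s)"
  have c: "0 < c" "c < 1" using s by (auto simp: c_def powr_less_one)
  have "C \<ge> 0" using C[of 1] a[of 1] by simp
  have pw: "n powr (-s) \<le> (\<Sum>j\<le>N. if n \<le> 2 ^ j then 2 powr s * (2 ^ j) powr (-s) else 0)"
    if n: "n \<in> {1..N}" for n N :: nat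
  proof -
    obtain k where k: "2 ^ k \<le> n" "n < 2 ^ (k + 1)"
      using ex_power_ivl1[of 2 n] n by auto
    have "k < n" using k(1) less_exp[of k] by linarith
    hence kN: "Suc k \<le> N" using n by simp
    \<comment> \<open>The single index j = k + 1 already suffices: the factor 2^s makes up for
      bounding n below by 2^k but above by 2^(k+1).\<close>
    have "2 powr s * (2 ^ Suc k :: real) powr (-s) = (2 ^ k :: real) powr (-s)"
      by (simp add: powr_mult powr_minus field_simps)
    also have "\<dots> \<ge> real n powr (-s)"
    proof (rule powr_mono2')
      show "(2::real) ^ k \<le> real n" using k(1) by (metis of_nat_le_iff of_nat_numeral of_nat_power)
    qed (use s in auto)
    also have "2 powr s * (2 ^ Suc k :: real) powr (-s)
        = (if n \<le> 2 ^ Suc k then 2 powr s * (2 ^ Suc k) powr (-s) else 0)"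
      using k(2) by simp
    also have "\<dots> \<le> (\<Sum>j\<le>N. if n \<le> 2 ^ j then 2 powr s * (2 ^ j) powr (-s) else 0)"
      by (rule member_le_sum[of "Suc k" "{..N}"]) (use kN in auto)
    finally show ?thesis .
  qed
  have "(\<Sum>n\<le>N. a n * real n powr (-s)) \<le> 2 powr s * C * (1 / (1 - c))" for N
  proof -
    have "(\<Sum>n\<le>N. a n * real n powr (-s)) = (\<Sum>n=1..N. a n * real n powr (-s))"
      by (rule sum.mono_neutral_right) (auto simp: Suc_le_eq)
    also have "\<dots> \<le> (\<Sum>n=1..N. a n * (\<Sum>j\<le>N. if n \<le> 2 ^ j then 2 powr s * (2 ^ j) powr (-s) else 0))"
      by (intro sum_mono mult_left_mono pw a) auto
    also have "\<dots> = (\<Sum>j\<le>N. \<Sum>n=1..N. a n * (if n \<le> 2 ^ j then 2 powr s * (2 ^ j) powr (-s) else 0))"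
      unfolding sum_distrib_left by (rule sum.swap)
    also have "\<dots> \<le> (\<Sum>j\<le>N. 2 powr s * C * c ^ j)"
    proof (rule sum_mono)
      fix j assume "j \<in> {..N}"
      have "(\<Sum>n=1..N. a n * (if n \<le> 2 ^ j then 2 powr s * (2 ^ j) powr (-s) else 0))
          = (\<Sum>n\<in>{n\<in>{1..N}. n \<le> 2 ^ j}. a n) * (2 powr s * (2 ^ j) powr (-s))"
        unfolding sum_distrib_right
        by (subst sum.inter_filter) (auto intro!: sum.cong)
      also have "\<dots> \<le> (\<Sum>n=1..2^j. a n) * (2 powr s * (2 ^ j) powr (-s))"
        by (intro mult_right_mono sum_mono2 a) auto
      also have "\<dots> \<le> (C * real (2 ^ j) powr p) * (2 powr s * (2 ^ j) powr (-s))"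
        by (intro mult_right_mono C) auto
      also have "\<dots> = 2 powr s * C * ((2 ^ j) powr p * (2 ^ j) powr (-s))" by simp
      also have "(2 ^ j :: real) powr p * (2 ^ j) powr (-s) = (2 ^ j) powr (p - s)"
        by (simp flip: powr_add)
      also have "\<dots> = c ^ j"
        by (simp add: c_def powr_power powr_powr mult.commute flip: powr_realpow)
      finally show "(\<Sum>n=1..N. a n * (if n \<le> 2 ^ j then 2 powr s * (2 ^ j) powr (-s) else 0))
          \<le> 2 powr s * C * c ^ j" .
    qed
    also have "\<dots> = 2 powr s * C * (\<Sum>j\<le>N. c ^ j)" by (simp add: sum_distrib_left)
    also have "\<dots> \<le> 2 powr s * C * (\<Sum>j. c ^ j)"
      by (intro mult_left_mono sum_le_suminf) (use c \<open>C \<ge> 0\<close> in auto)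
    also have "(\<Sum>j. c ^ j) = 1 / (1 - c)" using c by (simp add: suminf_geometric)
    finally show ?thesis .
  qed
  thus ?thesis by (intro bounded_imp_summable) (auto simp: a)
qed

lemma ramanujan_tau_summable:
  assumes "\<sigma> > 13 / 2"
  shows "summable (\<lambda>n. norm (ramanujan_tau n) * real n powr (-\<sigma>))"
proof -
  define \<delta> where "\<delta> = \<sigma> - 13 / 2"
  have \<delta>: "\<delta> > 0" using assms by (simp add: \<delta>_def)
  obtain C where C: "\<And>N. N > 0 \<Longrightarrow> (\<Sum>n=1..N. norm (ramanujan_tau n) ^ 2) \<le> C * real N ^ 12"
    using ramanujan_tau_mean_square by blast
  have "summable (\<lambda>n. norm (ramanujan_tau n) ^ 2 * real n powr (-(12 + \<delta>)))"
    by (rule summable_powr_of_partial_sums[where p = 12 and C = C]) (use C \<delta> in auto)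
  moreover have "summable (\<lambda>n. real n powr (-1 - \<delta>))"
    using \<delta> by (simp add: summable_real_powr_iff)
  ultimately have "summable (\<lambda>n. norm (ramanujan_tau n) ^ 2 * real n powr (-(12 + \<delta>)) + real n powr (-1 - \<delta>))"
    by (rule summable_add)
  thus ?thesis
  proof (rule summable_comparison_test'[of _ 0])
    fix n :: nat
    \<comment> \<open>With 13/2 + \<open>\<delta>\<close> = (12 + \<open>\<delta>\<close>)/2 + (1 +
      \<open>\<delta>\<close>)/2 the term splits as x y: the squares of x are summable by the
      mean-square bound, those of y as a p-series.\<close>
    define x where "x = norm (ramanujan_tau n) * real n powr (-(12 + \<delta>) / 2)"
    define y where "y = real n powr ((-1 - \<delta>) / 2)"
    have "norm (ramanujan_tau n) * real n powr (-\<sigma>) = x * y"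
      by (simp add: x_def y_def \<delta>_def mult.assoc flip: powr_add) (simp add: field_simps)
    also have "\<dots> \<le> x\<^sup>2 + y\<^sup>2"
    proof -
      have "0 \<le> x\<^sup>2 + y\<^sup>2 + (x - y)\<^sup>2" by simp
      thus ?thesis by (simp add: power2_eq_square algebra_simps)
    qed
    also have "\<dots> = norm (ramanujan_tau n) ^ 2 * real n powr (-(12 + \<delta>)) + real n powr (-1 - \<delta>)"
      by (simp add: x_def y_def power_mult_distrib power2_eq_square[of "_ powr _"] flip: powr_add)
    finally show "norm (norm (ramanujan_tau n) * real n powr (-\<sigma>)) \<le>
        norm (ramanujan_tau n) ^ 2 * real n powr (-(12 + \<delta>)) + real n powr (-1 - \<delta>)" by simp
  qed
qed

section \<open>The Mellin transform\<close>

abbreviation L_imag :: "real \<Rightarrow> complex" where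
  "L_imag w \<equiv> ramanujan_L (\<i> * of_real w)"

lemma L_imag_inversion:
  assumes "w > 0"
  shows "L_imag (1 / w) = of_real w ^ 12 * L_imag w"
proof -
  have "\<i> * of_real (1 / w) = -1 / (\<i> * of_real w)"
    using assms by (simp add: field_simps)
  hence "L_imag (1 / w) = (\<i> * of_real w) ^ 12 * L_imag w"
    using ramanujan_L_inversion[of "\<i> * of_real w"] assms by (simp only:) simp
  thus ?thesis by (simp add: power_mult_distrib)
qed

lemma continuous_on_L_imag: "S \<subseteq> {0<..} \<Longrightarrow> continuous_on S L_imag"
proof -
  have "(\<lambda>z. nome z * qprod (nome z) (nome z) ^ 24) holomorphic_on {z. Im z > 0}"
    by (intro holomorphic_intros holomorphic_on_compose_gen[OF _ holomorphic_qprod_self, unfolded o_def])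
      (auto intro: norm_nome_less_1)
  hence "ramanujan_L holomorphic_on {z. Im z > 0}"
    by (rule holomorphic_transform) (simp add: ramanujan_L_eq)
  hence "continuous_on {z. Im z > 0} ramanujan_L"
    by (rule holomorphic_on_imp_continuous_on)
  thus "continuous_on S L_imag" if "S \<subseteq> {0<..}"
    by (rule continuous_on_compose2) (use that in \<open>auto intro!: continuous_intros\<close>)
qed

text \<open>Inversion carries the exponential decay at infinity to 0, where it beats every power of
  w. The exponent k + 12 below also pays for the weight factor w^12.\<close>

lemma L_imag_vanishes_at_0:
  obtains C where "C > 0" "\<And>w. 0 < w \<Longrightarrow> w \<le> 1 \<Longrightarrow> norm (L_imag w) \<le> C * w ^ k"
proof -
  obtain M where M: "M > 0" "\<And>z. Im z \<ge> 1 / 2 \<Longrightarrow> norm (ramanujan_L z) \<le> M * exp (- 2 * pi * Im z)"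
    using ramanujan_L_exp_bound by blast
  obtain B where B: "B > 0" "\<And>t. t \<ge> 0 \<Longrightarrow> t ^ (k + 12) * exp (- (2 * pi) * t) \<le> B"
    using power_times_exp_bounded[of "2 * pi" "k + 12"] by auto
  have "norm (L_imag w) \<le> (M * B) * w ^ k" if w: "0 < w" "w \<le> 1" for w
  proof -
    have "1 / w \<ge> 1" using w by simp
    hence "norm (L_imag (1 / w)) \<le> M * exp (- 2 * pi * (1 / w))"
      using M(2)[of "\<i> * of_real (1 / w)"] by (simp del: of_real_divide)
    moreover have "norm (L_imag (1 / w)) = w ^ 12 * norm (L_imag w)"
      unfolding L_imag_inversion[OF w(1)] using w by (simp add: norm_mult norm_power)
    ultimately have "w ^ 12 * norm (L_imag w) \<le> M * exp (- 2 * pi * (1 / w))" by simp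
    hence "(1 / w) ^ (k + 12) * (w ^ 12 * norm (L_imag w)) \<le> (1 / w) ^ (k + 12) * (M * exp (- 2 * pi * (1 / w)))"
      using w by (intro mult_left_mono) auto
    also have "\<dots> = M * ((1 / w) ^ (k + 12) * exp (- (2 * pi) * (1 / w)))" by simp
    also have "\<dots> \<le> M * B" using w M(1) by (intro mult_left_mono B(2)) auto
    also have "(1 / w) ^ (k + 12) * (w ^ 12 * norm (L_imag w)) = norm (L_imag w) / w ^ k"
      using w by (simp add: power_add field_simps)
    finally show ?thesis using w by (simp add: field_simps)
  qed
  thus thesis using that[of "M * B"] M(1) B(1) by simp
qed

text \<open>On (0,1] the exponential is w^(-c), which vanishing to order k >= c absorbs. Arbitrary
  real c is what later permits arbitrary complex \<open>\<phi>\<close>: the terms of the cosine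
  series are dominated with c = |\<open>\<phi>\<close>|.\<close>

lemma wilton_kernel_bound:
  fixes c :: real
  obtains C where "\<And>w. 0 < w \<Longrightarrow> w \<le> 1 \<Longrightarrow> norm (L_imag w) * w ^ 5 * exp (c * \<bar>ln w\<bar>) \<le> C"
proof -
  define k where "k = nat \<lceil>c\<rceil>"
  obtain C where C: "C > 0" "\<And>w. 0 < w \<Longrightarrow> w \<le> 1 \<Longrightarrow> norm (L_imag w) \<le> C * w ^ k"
    using L_imag_vanishes_at_0[of k] by blast
  have "norm (L_imag w) * w ^ 5 * exp (c * \<bar>ln w\<bar>) \<le> C" if w: "0 < w" "w \<le> 1" for w
  proof -
    have "c \<le> real k" unfolding k_def by linarith
    hence "exp (c * \<bar>ln w\<bar>) \<le> exp (real k * \<bar>ln w\<bar>)"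
      by (simp add: mult_right_mono)
    also have "\<dots> = exp (\<bar>ln w\<bar>) ^ k" by (rule exp_of_nat_mult)
    also have "exp \<bar>ln w\<bar> = 1 / w" using w by (simp add: exp_minus ln_le_zero_iff field_simps)
    finally have "norm (L_imag w) * w ^ 5 * exp (c * \<bar>ln w\<bar>) \<le> (C * w ^ k) * 1 * (1 / w) ^ k"
      using w by (intro mult_mono C(2) power_le_one mult_nonneg_nonneg) (use C(1) in auto)
    also have "\<dots> = C" using w by (simp add: field_simps)
    finally show ?thesis .
  qed
  thus thesis by (rule that)
qed

section \<open>The folded integral and its power series\<close>

lemma even_exp_partial_sum_le:
  fixes y :: real
  assumes "y \<ge> 0"
  shows "(\<Sum>s<N. y ^ (2 * s) / fact (2 * s)) \<le> exp y"
proof -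
  have "(\<Sum>s<N. y ^ (2 * s) / fact (2 * s)) = (\<Sum>n\<in>(\<lambda>s. 2 * s) ` {..<N}. y ^ n / fact n)"
    by (subst sum.reindex) (auto simp: inj_on_def)
  also have "\<dots> \<le> (\<Sum>n. y ^ n / fact n)"
    by (intro sum_le_suminf) (use assms summable_exp[of y] in \<open>auto simp: field_simps\<close>)
  also have "\<dots> = exp y" by (simp add: exp_def field_simps)
  finally show ?thesis .
qed

lemma cos_sums_even:
  fixes x :: complex
  shows "(\<lambda>s. (-1) ^ s * x ^ (2 * s) / fact (2 * s)) sums cos x"
proof -
  have "(\<lambda>s. cos_coeff (2 * s) *\<^sub>R x ^ (2 * s)) sums cos x
      \<longleftrightarrow> (\<lambda>n. cos_coeff n *\<^sub>R x ^ n) sums cos x"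
  proof (rule sums_mono_reindex)
    fix n :: nat assume "n \<notin> range (\<lambda>s. 2 * s)"
    hence "odd n" by (metis evenE rangeI)
    thus "cos_coeff n *\<^sub>R x ^ n = 0" by (simp add: cos_coeff_def)
  qed (simp add: strict_mono_def)
  hence "(\<lambda>s. cos_coeff (2 * s) *\<^sub>R x ^ (2 * s)) sums cos x"
    using cos_converges by blast
  thus ?thesis by (simp add: cos_coeff_def scaleR_conv_of_real)
qed

lemma integrable_on_const_Ioc: "(\<lambda>_. C :: real) integrable_on {0<..1::real}"
proof (rule integrable_spike_set)
  show "(\<lambda>_. C) integrable_on {0..1::real}" by (rule integrable_const_ivl)
  show "negligible {x \<in> {0..1} - {0<..1::real}. C \<noteq> 0}"
    by (rule negligible_subset[of "{0}"]) auto
  show "negligible {x \<in> {0<..1} - {0..1::real}. C \<noteq> 0}"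
    by (rule negligible_subset[of "{0}"]) auto
qed

text \<open>The Mellin transform of L(iw) folded onto (0,1], in the variable \<open>\<phi>\<close> =
  (x - 6)/i. Leaving out the boundary point 0 makes the integrand continuous on the domain.\<close>

definition wilton_integral :: "complex \<Rightarrow> complex" where
  "wilton_integral \<phi> = 2 * integral {0<..1} (\<lambda>w. L_imag w * of_real w ^ 5 * cos (\<phi> * of_real (ln w)))"

lemma chi_sums_wilton_integral:
  "(\<lambda>s. chi s * (-1) ^ s * \<phi> ^ (2 * s)) sums wilton_integral \<phi>"
proof -
  define F where "F s w = L_imag w * of_real w ^ 5 * (of_real (ln w) ^ (2 * s) / fact (2 * s))"
    for s :: nat and w :: real
  \<comment> \<open>Stated for general coefficients because it serves twice: with an indicator and a
    = 1 it bounds a single \<open>F s\<close>, and with the coefficients (-1)^s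
    \<open>\<phi>\<close>^(2s) and a = |\<open>\<phi>\<close>| the partial sums, uniformly in
    N.\<close>
  have bound: "norm (\<Sum>s<N. F s w * c s) \<le> norm (L_imag w) * w ^ 5 * exp (a * \<bar>ln w\<bar>)"
    if w: "0 < w" and c: "\<And>s. norm (c s) \<le> a ^ (2 * s)" and a: "a \<ge> 0" for N w a and c :: "nat \<Rightarrow> complex"
  proof -
    have "norm (\<Sum>s<N. F s w * c s) \<le> (\<Sum>s<N. norm (L_imag w) * w ^ 5 * ((a * \<bar>ln w\<bar>) ^ (2 * s) / fact (2 * s)))"
    proof (rule sum_norm_le)
      fix s
      have "norm (F s w * c s) = norm (L_imag w) * w ^ 5 * (\<bar>ln w\<bar> ^ (2 * s) / fact (2 * s)) * norm (c s)"
        using w by (simp add: F_def norm_mult norm_power norm_divide)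
      also have "\<dots> \<le> norm (L_imag w) * w ^ 5 * (\<bar>ln w\<bar> ^ (2 * s) / fact (2 * s)) * a ^ (2 * s)"
        using w by (intro mult_left_mono c) auto
      also have "\<dots> = norm (L_imag w) * w ^ 5 * ((a * \<bar>ln w\<bar>) ^ (2 * s) / fact (2 * s))"
        unfolding power_mult_distrib by simp
      finally show "norm (F s w * c s) \<le> \<dots>" .
    qed
    also have "\<dots> = norm (L_imag w) * w ^ 5 * (\<Sum>s<N. (a * \<bar>ln w\<bar>) ^ (2 * s) / fact (2 * s))"
      by (simp add: sum_distrib_left)
    also have "\<dots> \<le> norm (L_imag w) * w ^ 5 * exp (a * \<bar>ln w\<bar>)"
      using w a by (intro mult_left_mono even_exp_partial_sum_le) auto
    finally show ?thesis .
  qed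
  have int_F: "F s integrable_on {0<..1}" for s
  proof -
    obtain C where C: "\<And>w. 0 < w \<Longrightarrow> w \<le> 1 \<Longrightarrow> norm (L_imag w) * w ^ 5 * exp (1 * \<bar>ln w\<bar>) \<le> C"
      using wilton_kernel_bound[of 1] by blast
    show ?thesis
    proof (rule measurable_bounded_by_integrable_imp_integrable)
      have "continuous_on {0<..1} (F s)"
        unfolding F_def by (intro continuous_intros continuous_on_L_imag) auto
      thus "F s \<in> borel_measurable (lebesgue_on {0<..1})"
        by (rule continuous_imp_measurable_on_sets_lebesgue) auto
      fix w :: real assume w: "w \<in> {0<..1}"
      have "norm (\<Sum>r<Suc s. F r w * (if r = s then 1 else 0)) \<le> norm (L_imag w) * w ^ 5 * exp (1 * \<bar>ln w\<bar>)"
        by (rule bound) (use w in auto)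
      also have "(\<Sum>r<Suc s. F r w * (if r = s then 1 else 0)) = F s w"
        by simp
      finally show "norm (F s w) \<le> C" using C[of w] w by force
    qed (auto intro: integrable_on_const_Ioc)
  qed
  define G where "G w = L_imag w * of_real w ^ 5 * cos (\<phi> * of_real (ln w))" for w :: real
  obtain C where C: "\<And>w. 0 < w \<Longrightarrow> w \<le> 1 \<Longrightarrow> norm (L_imag w) * w ^ 5 * exp (norm \<phi> * \<bar>ln w\<bar>) \<le> C"
    using wilton_kernel_bound[of "norm \<phi>"] by blast
  have "(\<lambda>N. integral {0<..1} (\<lambda>w. \<Sum>s<N. F s w * ((-1) ^ s * \<phi> ^ (2 * s)))) \<longlonglongrightarrow> integral {0<..1} G"
  proof (rule dominated_convergence)
    show "(\<lambda>w. \<Sum>s<N. F s w * ((-1) ^ s * \<phi> ^ (2 * s))) integrable_on {0<..1}" for N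
      by (intro integrable_sum integrable_on_mult_left int_F) auto
    show "(\<lambda>_. C) integrable_on {0<..1::real}" by (rule integrable_on_const_Ioc)
    fix w :: real assume w: "w \<in> {0<..1}"
    show "norm (\<Sum>s<N. F s w * ((-1) ^ s * \<phi> ^ (2 * s))) \<le> C" for N
      using bound[of w "\<lambda>s. (-1) ^ s * \<phi> ^ (2 * s)" "norm \<phi>" N] C[of w] w
      by (simp add: norm_mult norm_power)
    have "(\<lambda>s. L_imag w * of_real w ^ 5 * ((-1) ^ s * (\<phi> * of_real (ln w)) ^ (2 * s) / fact (2 * s))) sums G w"
      unfolding G_def by (intro sums_mult cos_sums_even)
    also have "(\<lambda>s. L_imag w * of_real w ^ 5 * ((-1) ^ s * (\<phi> * of_real (ln w)) ^ (2 * s) / fact (2 * s)))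
        = (\<lambda>s. F s w * ((-1) ^ s * \<phi> ^ (2 * s)))"
      by (simp add: F_def fun_eq_iff power_mult_distrib)
    finally show "(\<lambda>N. \<Sum>s<N. F s w * ((-1) ^ s * \<phi> ^ (2 * s))) \<longlonglongrightarrow> G w"
      by (simp add: sums_def)
  qed
  also have "(\<lambda>N. integral {0<..1} (\<lambda>w. \<Sum>s<N. F s w * ((-1) ^ s * \<phi> ^ (2 * s))))
      = (\<lambda>N. \<Sum>s<N. integral {0<..1} (F s) * ((-1) ^ s * \<phi> ^ (2 * s)))"
    by (subst integral_sum) (auto intro!: integrable_on_mult_left int_F)
  finally have "(\<lambda>s. integral {0<..1} (F s) * ((-1) ^ s * \<phi> ^ (2 * s))) sums integral {0<..1} G"
    by (simp add: sums_def)
  hence "(\<lambda>s. 2 * (integral {0<..1} (F s) * ((-1) ^ s * \<phi> ^ (2 * s)))) sums (2 * integral {0<..1} G)"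
    by (rule sums_mult)
  moreover have "chi s = 2 * integral {0<..1} (F s)" for s
  proof -
    have "integral {0..1} (F s) = integral {0<..1} (F s)"
    proof (rule integral_spike_set)
      \<comment> \<open>At the extra point 0 the factor w^5 vanishes.\<close>
      have "{x \<in> {0..1} - {0<..1}. F s x \<noteq> 0} = {}" by (auto simp: F_def not_less)
      thus "negligible {x \<in> {0..1} - {0<..1}. F s x \<noteq> 0}" by (metis negligible_empty)
      have "{x \<in> {0<..1} - {0..1}. F s x \<noteq> 0} = {}" by auto
      thus "negligible {x \<in> {0<..1} - {0..1}. F s x \<noteq> 0}" by (metis negligible_empty)
    qed
    thus ?thesis unfolding chi_def F_def [abs_def] by (rule arg_cong)
  qed
  ultimately show ?thesis
    unfolding wilton_integral_def G_def [abs_def] by (simp only: mult.assoc)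
qed

text \<open>The expansion is a power series in u = \<open>\<phi>\<close>^2 that converges
  everywhere. \<open>csqrt\<close> only names its sum \<open>P u\<close>: with even powers alone,
  both square roots give the same series.\<close>

lemma holomorphic_wilton_integral:
  "wilton_integral holomorphic_on UNIV"
proof -
  define P where "P u = wilton_integral (csqrt u)" for u
  have sums: "(\<lambda>s. chi s * (-1) ^ s * (u - 0) ^ s) sums P u" for u
    using chi_sums_wilton_integral[of "csqrt u"] by (simp add: P_def power_mult)
  have "P holomorphic_on ball 0 r" for r
    by (rule power_series_holomorphic) (rule sums)
  hence "P field_differentiable at u" for u
    by (rule holomorphic_on_imp_differentiable_at[of _ "ball 0 (norm u + 1)"]) auto
  hence "P holomorphic_on UNIV" by (simp add: field_differentiable_at_within holomorphic_on_def)
  hence "(\<lambda>\<phi>. P (\<phi>\<^sup>2)) holomorphic_on UNIV"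
    by (rule holomorphic_on_compose_gen[OF _ _ subset_UNIV, unfolded o_def, rotated])
      (intro holomorphic_intros)
  moreover have "P (\<phi>\<^sup>2) = wilton_integral \<phi>" for \<phi>
  proof (rule sums_unique2)
    show "(\<lambda>s. chi s * (-1) ^ s * \<phi> ^ (2 * s)) sums P (\<phi>\<^sup>2)"
      using sums[of "\<phi>\<^sup>2"] by (simp add: power_mult)
  qed (rule chi_sums_wilton_integral)
  ultimately show ?thesis by simp
qed

section \<open>Termwise Mellin transform of the q-expansion\<close>

lemma mellin_exp:
  fixes x :: complex and a :: real
  assumes x: "Re x > 0" and a: "a > 0"
  defines "f \<equiv> \<lambda>t::real. of_real t powr (x - 1) * of_real (exp (- a * t))"
  shows "integrable (lebesgue_on {0<..}) f"
    and "integral\<^sup>L (lebesgue_on {0<..}) f = Gamma x * of_real a powr (-x)"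
proof -
  let ?S = "{0<..} :: real set"
  define g where "g t = of_real t powr (x - 1) / of_real (exp t)" for t :: real
  have img: "(\<lambda>t. a * t) ` ?S = ?S"
  proof
    show "?S \<subseteq> (\<lambda>t. a * t) ` ?S"
    proof
      fix t assume "t \<in> ?S"
      thus "t \<in> (\<lambda>t. a * t) ` ?S" using a by (intro image_eqI[of _ _ "t / a"]) auto
    qed
  qed (use a in auto)
  have g: "g absolutely_integrable_on ?S" "integral ?S g = Gamma x"
    using absolutely_integrable_Gamma_integral'[OF x] integral_unique[OF Gamma_integral_complex'[OF x]]
    by (simp_all add: g_def [abs_def])
  \<comment> \<open>Gamma's integral after the substitution t -> a t.\<close>
  have "(\<lambda>t. \<bar>a\<bar> *\<^sub>R g (a * t)) absolutely_integrable_on ?S \<and> integral ?S (\<lambda>t. \<bar>a\<bar> *\<^sub>R g (a * t)) = Gamma x"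
    by (subst has_absolute_integral_change_of_variables_real)
      (use a g img in \<open>auto intro!: derivative_eq_intros simp: inj_on_def\<close>)
  moreover have eq: "\<bar>a\<bar> *\<^sub>R g (a * t) = of_real a powr x * f t" if "t \<in> ?S" for t
  proof -
    have "of_real (a * t) powr (x - 1) = (of_real a powr (x - 1) * of_real t powr (x - 1) :: complex)"
      unfolding of_real_mult using a that by (intro powr_times_real) auto
    moreover have "of_real a * of_real a powr (x - 1) = (of_real a powr x :: complex)"
      using a by (simp add: powr_diff)
    ultimately show ?thesis
      using a by (simp add: g_def f_def scaleR_conv_of_real exp_minus field_simps)
  qed
  moreover have "(\<lambda>t. \<bar>a\<bar> *\<^sub>R g (a * t)) absolutely_integrable_on ?S
      \<longleftrightarrow> (\<lambda>t. of_real a powr x * f t) absolutely_integrable_on ?S"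
    by (intro set_integrable_cong refl eq)
  moreover have "integral ?S (\<lambda>t. \<bar>a\<bar> *\<^sub>R g (a * t)) = integral ?S (\<lambda>t. of_real a powr x * f t)"
    by (intro integral_cong eq)
  ultimately have h: "(\<lambda>t. of_real a powr x * f t) absolutely_integrable_on ?S"
      "integral ?S (\<lambda>t. of_real a powr x * f t) = Gamma x"
    by simp_all
  have [simp]: "of_real a powr x \<noteq> (0 :: complex)" using a by simp
  have int_a: "integrable (lebesgue_on ?S) (\<lambda>t. of_real a powr x * f t)"
    by (rule absolutely_integrable_imp_integrable[OF h(1)]) auto
  have cancel: "of_real a powr (-x) * (of_real a powr x * z) = z" for z :: complex
    using a by (simp add: powr_minus)
  show "integrable (lebesgue_on ?S) f"
    using integrable_mult_right[OF int_a, of "of_real a powr (-x)"] by (simp only: cancel)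
  have "of_real a powr x * integral\<^sup>L (lebesgue_on ?S) f = integral\<^sup>L (lebesgue_on ?S) (\<lambda>t. of_real a powr x * f t)"
    by simp
  also have "\<dots> = Gamma x"
    by (subst lebesgue_integral_eq_integral[OF int_a]) (simp, rule h(2))
  finally show "integral\<^sup>L (lebesgue_on ?S) f = Gamma x * of_real a powr (-x)"
    using a by (simp add: powr_minus field_simps)
qed

text \<open>Integrating term by term requires the integrals of the norms to be summable. Up to a
  constant, their sum is the Dirichlet series of |tau(n)| at Re x, which is where Re x > 13/2
  enters.\<close>

lemma mellin_L_imag:
  assumes x: "Re x > 13 / 2"
  defines "h \<equiv> \<lambda>t. L_imag t * of_real t powr (x - 1)"
  shows "h absolutely_integrable_on {0<..}"
    and "integral {0<..} h = of_real (2 * pi) powr (-x) * Gamma x * ramanujan_dirichlet_series x"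
proof -
  let ?S = "{0<..} :: real set"
  define a where "a n = 2 * pi * real (Suc n)" for n
  have a: "a n > 0" for n by (simp add: a_def)
  define f where "f n t = ramanujan_tau (Suc n) * (of_real t powr (x - 1) * of_real (exp (- a n * t)))"
    for n and t :: real
  have powr_a: "of_real (a n) powr (-z) = of_real (2 * pi) powr (-z) * of_nat (Suc n) powr (-z)" for n and z :: complex
  proof -
    have "of_real (a n) = of_real (2 * pi) * (of_nat (Suc n) :: complex)" by (simp add: a_def)
    thus ?thesis by (simp only:, intro powr_times_real) auto
  qed
  have int_f: "integrable (lebesgue_on ?S) (f n)"
    and f_eq: "integral\<^sup>L (lebesgue_on ?S) (f n)
      = of_real (2 * pi) powr (-x) * Gamma x * (ramanujan_tau (Suc n) * of_nat (Suc n) powr (-x))" for n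
    using mellin_exp[of x "a n"] a[of n] x unfolding f_def powr_a by (auto simp: mult_ac)
  \<comment> \<open>Since |t^(x-1)| = t^(Re x - 1), this is the same Mellin integral at the real
    point Re x. Taking norms on both sides of the complex identity avoids a separate discussion of
    the sign of Gamma.\<close>
  have int_norm: "(\<integral>t. norm (f n t) \<partial>lebesgue_on ?S)
      = norm (of_real (2 * pi) powr (- of_real (Re x)) * Gamma (of_real (Re x) :: complex))
          * (norm (ramanujan_tau (Suc n)) * real (Suc n) powr (- Re x))" for n
  proof -
    have "complex_of_real (\<integral>t. norm (f n t) \<partial>lebesgue_on ?S) =
        (\<integral>t. complex_of_real (norm (ramanujan_tau (Suc n))) *
          (of_real t powr (of_real (Re x) - 1) * of_real (exp (- a n * t))) \<partial>lebesgue_on ?S)"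
      unfolding integral_complex_of_real[symmetric]
      by (intro Bochner_Integration.integral_cong refl)
        (auto simp: f_def norm_mult norm_powr_real_powr powr_of_real[symmetric])
    also have "\<dots> = of_real (norm (ramanujan_tau (Suc n))) *
        (Gamma (of_real (Re x)) * (of_real (2 * pi) powr (- of_real (Re x)) * of_nat (Suc n) powr (- of_real (Re x))))"
      using mellin_exp[of "of_real (Re x)" "a n"] a[of n] x unfolding powr_a by simp
    finally have "norm (complex_of_real (\<integral>t. norm (f n t) \<partial>lebesgue_on ?S)) = norm \<dots>" by simp
    moreover have "norm (of_nat (Suc n) powr (- of_real (Re x)) :: complex) = real (Suc n) powr (- Re x)"
      by (simp add: norm_powr_real_powr del: of_nat_Suc)
    ultimately show ?thesis
      by (simp only: norm_of_real norm_mult abs_of_nonneg integral_nonneg_AE) 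
         (simp add: mult_ac)
  qed
  have tau: "summable (\<lambda>n. norm (ramanujan_tau (Suc n)) * real (Suc n) powr (- Re x))"
    using ramanujan_tau_summable[OF x] by (subst summable_Suc_iff)
  have sums_f: "(\<lambda>n. f n t) sums h t" and abs_f: "summable (\<lambda>n. norm (f n t))" if t: "t \<in> ?S" for t
  proof -
    have nome: "nome (\<i> * of_real t) ^ Suc n = of_real (exp (- a n * t))" for n
      unfolding a_def nome_def exp_of_nat_mult[symmetric] exp_of_real[symmetric]
      by (rule arg_cong[where f = exp]) (simp add: algebra_simps)
    have "(\<lambda>n. ramanujan_tau n * nome (\<i> * of_real t) ^ n) sums L_imag t"
      using ramanujan_L_sums[of "\<i> * of_real t"] t by simp
    hence "(\<lambda>n. ramanujan_tau (Suc n) * nome (\<i> * of_real t) ^ Suc n) sums L_imag t"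
      by (subst sums_Suc_iff) (simp add: ramanujan_tau_0)
    from sums_mult2[OF this, of "of_real t powr (x - 1)"]
    show "(\<lambda>n. f n t) sums h t"
      unfolding nome by (simp add: f_def h_def mult_ac)
    define q where "q = nome (\<i> * of_real t)"
    have q: "norm q < 1" unfolding q_def using t by (intro norm_nome_less_1) simp
    \<comment> \<open>A radius strictly between |q| and 1: convergence at \<open>r\<close> gives
      absolute convergence at \<open>q\<close>.\<close>
    define r where "r = (norm q + 1) / 2"
    have "summable (\<lambda>n. ramanujan_tau n * of_real r ^ n)"
      using ramanujan_tau_sums[of "of_real r"] q by (auto simp: r_def sums_iff)
    hence "summable (\<lambda>n. norm (ramanujan_tau n * q ^ n))"
      by (rule powser_insidea) (use q in \<open>simp add: r_def\<close>)
    hence "summable (\<lambda>n. norm (ramanujan_tau (Suc n) * q ^ Suc n))"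
      by (subst summable_Suc_iff)
    from summable_mult2[OF this, of "norm (complex_of_real t powr (x - 1))"]
    show "summable (\<lambda>n. norm (f n t))"
      unfolding q_def nome by (simp add: f_def norm_mult mult_ac)
  qed
  have AE: "AE t in lebesgue_on ?S. summable (\<lambda>n. norm (f n t))"
    by (rule AE_I2) (use abs_f in auto)
  have summ: "summable (\<lambda>n. \<integral>t. norm (f n t) \<partial>lebesgue_on ?S)"
    unfolding int_norm by (intro summable_mult tau)
  note conds = int_f AE summ
  have h_eq: "(\<Sum>n. f n t) = h t" if "t \<in> ?S" for t
    using sums_f[OF that] by (simp add: sums_iff)
  have "integrable (lebesgue_on ?S) (\<lambda>t. \<Sum>n. f n t)"
    by (rule integrable_suminf[OF conds])
  hence int_h: "integrable (lebesgue_on ?S) h"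
    by (rule Bochner_Integration.integrable_cong[THEN iffD1, rotated -1]) (use h_eq in auto)
  thus "h absolutely_integrable_on ?S"
    unfolding set_integrable_def by (subst (asm) integrable_restrict_space) auto
  have "(\<lambda>n. integral\<^sup>L (lebesgue_on ?S) (f n)) sums (\<integral>t. (\<Sum>n. f n t) \<partial>lebesgue_on ?S)"
    by (rule sums_integral[OF conds])
  also have "(\<integral>t. (\<Sum>n. f n t) \<partial>lebesgue_on ?S) = integral\<^sup>L (lebesgue_on ?S) h"
    by (intro Bochner_Integration.integral_cong refl) (use h_eq in auto)
  also have "\<dots> = integral ?S h"
    by (rule lebesgue_integral_eq_integral[OF int_h]) auto
  finally have "(\<lambda>n. of_real (2 * pi) powr (-x) * Gamma x * (ramanujan_tau (Suc n) * of_nat (Suc n) powr (-x)))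
      sums integral ?S h"
    unfolding f_eq .
  moreover have "summable (\<lambda>n. ramanujan_tau (Suc n) * of_nat (Suc n) powr (-x))"
    by (rule summable_norm_cancel)
      (use tau in \<open>simp add: norm_mult norm_powr_real_powr del: of_nat_Suc\<close>)
  hence "(\<lambda>n. of_real (2 * pi) powr (-x) * Gamma x * (ramanujan_tau (Suc n) * of_nat (Suc n) powr (-x)))
      sums (of_real (2 * pi) powr (-x) * Gamma x * ramanujan_dirichlet_series x)"
    unfolding ramanujan_dirichlet_series_def by (intro sums_mult summable_sums)
  ultimately show "integral ?S h = of_real (2 * pi) powr (-x) * Gamma x * ramanujan_dirichlet_series x"
    using sums_unique2 by blast
qed

lemma wilton_integral_eq_dirichlet:
  assumes x: "Re x > 13 / 2"
  shows "wilton_integral ((x - 6) / \<i>)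
    = of_real (2 * pi) powr (-x) * Gamma x * ramanujan_dirichlet_series x"
proof -
  define h where "h t = L_imag t * of_real t powr (x - 1)" for t
  \<comment> \<open>The image of \<open>h\<close> under t -> 1/t: the inversion formula gives t^12,
    the Jacobian t^(-2) and the power t^(1-x), in total t^(11-x).\<close>
  define k where "k t = L_imag t * of_real t powr (11 - x)" for t
  have h: "h absolutely_integrable_on {0<..}"
    and h_eq: "integral {0<..} h = of_real (2 * pi) powr (-x) * Gamma x * ramanujan_dirichlet_series x"
    using mellin_L_imag[OF x] by (simp_all add: h_def [abs_def])
  have h1: "h absolutely_integrable_on {0<..1}" "h absolutely_integrable_on {1..}"
    by (rule set_integrable_subset[OF h]; auto)+
  have img: "(\<lambda>t::real. 1 / t) ` {0<..1} = {1..}"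
  proof
    show "{1..} \<subseteq> (\<lambda>t::real. 1 / t) ` {0<..1}"
    proof
      fix t :: real assume "t \<in> {1..}"
      thus "t \<in> (\<lambda>t. 1 / t) ` {0<..1}" by (intro image_eqI[of _ _ "1 / t"]) auto
    qed
  qed auto
  have k_eq: "\<bar>- 1 / t\<^sup>2\<bar> *\<^sub>R h (1 / t) = k t" if t: "t \<in> {0<..1}" for t :: real
  proof -
    have "t > 0" using t by simp
    have "complex_of_real (1 / t) powr (x - 1) = of_real t powr (1 - x)"
    proof -
      have "Ln (of_real (1 / t)) = - of_real (ln t)"
        using \<open>t > 0\<close> by (subst Ln_of_real) (simp_all add: ln_div)
      thus ?thesis
        using \<open>t > 0\<close> unfolding powr_def by (simp add: Ln_of_real algebra_simps)
    qed
    moreover have "of_real t powr (11 - x) = of_real t powr (1 - x) * complex_of_real t ^ 10"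
    proof -
      have "of_real t powr (1 - x + of_nat 10) = of_real t powr (1 - x) * complex_of_real t ^ 10"
        using \<open>t > 0\<close> by (subst powr_add) (simp add: powr_nat')
      moreover have "1 - x + of_nat 10 = 11 - x" by simp
      ultimately show ?thesis by (simp only:)
    qed
    moreover have "z ^ 12 * l * p / z\<^sup>2 = l * (p * z ^ 10)" if "z \<noteq> 0" for z l p :: complex
      using that by (simp add: field_simps eval_nat_numeral)
    ultimately show ?thesis
      using \<open>t > 0\<close>
      unfolding h_def k_def L_imag_inversion[OF \<open>t > 0\<close>]
      by (simp add: scaleR_conv_of_real)
  qed
  have "(\<lambda>t. \<bar>- 1 / t\<^sup>2\<bar> *\<^sub>R h (1 / t)) absolutely_integrable_on {0<..1}
      \<and> integral {0<..1} (\<lambda>t. \<bar>- 1 / t\<^sup>2\<bar> *\<^sub>R h (1 / t)) = integral {1..} h"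
    by (subst has_absolute_integral_change_of_variables_real)
      (use h1 in \<open>auto intro!: derivative_eq_intros simp: inj_on_def img power2_eq_square\<close>)
  moreover have "(\<lambda>t. \<bar>- 1 / t\<^sup>2\<bar> *\<^sub>R h (1 / t)) absolutely_integrable_on {0<..1}
      \<longleftrightarrow> k absolutely_integrable_on {0<..1}"
    by (intro set_integrable_cong refl k_eq)
  moreover have "integral {0<..1} (\<lambda>t. \<bar>- 1 / t\<^sup>2\<bar> *\<^sub>R h (1 / t)) = integral {0<..1} k"
    by (intro integral_cong k_eq)
  ultimately have k: "k absolutely_integrable_on {0<..1}" "integral {0<..1} k = integral {1..} h"
    by simp_all
  have "(h has_integral (integral {0<..1} h + integral {1..} h)) ({0<..1} \<union> {1..})"
  proof (rule has_integral_Un)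
    have "{0<..1} \<inter> {1..} = {1::real}" by auto
    thus "negligible ({0<..1} \<inter> {1..} :: real set)" by simp
  qed (use h1 in \<open>auto simp: absolutely_integrable_on_def intro!: integrable_integral\<close>)
  moreover have "{0<..1} \<union> {1..} = ({0<..} :: real set)" by auto
  ultimately have "integral {0<..} h = integral {0<..1} h + integral {0<..1} k"
    by (simp add: k(2) integral_unique)
  also have "\<dots> = integral {0<..1} (\<lambda>t. h t + k t)"
    using h1 k by (intro integral_add[symmetric]) (auto simp: absolutely_integrable_on_def)
  \<comment> \<open>The exponents x - 1 = 5 + (x - 6) and 11 - x = 5 - (x - 6) are symmetric about
    5, so the two powers add up to 2 t^5 times a cosine.\<close>
  also have "\<dots> = integral {0<..1} (\<lambda>t. 2 * (L_imag t * of_real t ^ 5 * cos ((x - 6) / \<i> * of_real (ln t))))"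
  proof (rule integral_cong)
    fix t :: real assume "t \<in> {0<..1}"
    hence t: "t > 0" by simp
    have "\<i> * ((x - 6) / \<i> * c) = (\<i> / \<i>) * ((x - 6) * c)" for c
      by (simp only: times_divide_eq_left times_divide_eq_right mult_ac)
    hence cancel: "\<i> * ((x - 6) / \<i> * c) = (x - 6) * c" for c
      by (simp only: divide_self_if complex_i_not_zero if_False mult_1_left)
    have "of_real t powr (x - 1) = complex_of_real t ^ 5 * exp (\<i> * ((x - 6) / \<i> * of_real (ln t)))"
    proof -
      have "of_real t powr (of_nat 5 + (x - 6)) = complex_of_real t ^ 5 * of_real t powr (x - 6)"
        using t by (subst powr_add) (simp add: powr_nat')
      moreover have "of_nat 5 + (x - 6) = x - 1" by simp
      ultimately show ?thesis using t unfolding cancel by (simp only:) (simp add: powr_def Ln_of_real)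
    qed
    moreover have "of_real t powr (11 - x) = complex_of_real t ^ 5 * exp (- (\<i> * ((x - 6) / \<i> * of_real (ln t))))"
    proof -
      have "of_real t powr (of_nat 5 + (6 - x)) = complex_of_real t ^ 5 * of_real t powr (6 - x)"
        using t by (subst powr_add) (simp add: powr_nat')
      moreover have "of_nat 5 + (6 - x) = 11 - x" by simp
      ultimately show ?thesis using t unfolding cancel
        by (simp only:) (simp add: powr_def Ln_of_real algebra_simps)
    qed
    ultimately show "h t + k t = 2 * (L_imag t * of_real t ^ 5 * cos ((x - 6) / \<i> * of_real (ln t)))"
      by (simp only: h_def k_def cos_exp_eq) (simp add: algebra_simps)
  qed
  also have "\<dots> = wilton_integral ((x - 6) / \<i>)"
    by (simp add: wilton_integral_def)
  finally show ?thesis using h_eq by simp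
qed

section \<open>Identification of the entire extensions\<close>

lemma entire_eqI:
  fixes f g :: "complex \<Rightarrow> complex"
  assumes "f holomorphic_on UNIV" "g holomorphic_on UNIV" "\<And>x. Re x > c \<Longrightarrow> f x = g x"
  shows "f = g"
proof
  fix z
  show "f z = g z"
  proof (rule analytic_continuation_open[of "{x. Re x > c}" UNIV f g])
    have "of_real (c + 1) \<in> {x. Re x > c}" by simp
    thus "{x. Re x > c} \<noteq> {}" by blast
  qed (use assms open_halfspace_Re_gt in auto)
qed

lemma not_nonpos_Int_of_Re_pos: "Re x > 0 \<Longrightarrow> x \<notin> \<int>\<^sub>\<le>\<^sub>0"
proof
  assume "Re x > 0" "x \<in> \<int>\<^sub>\<le>\<^sub>0"
  then obtain n where "x = of_int n" "n \<le> 0" by (elim nonpos_Ints_cases)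
  thus False using \<open>Re x > 0\<close> by simp
qed

text \<open>Dividing by Gamma is multiplying by the entire function \<open>rGamma\<close>, so the
  right-hand side is entire as written and is a witness for the continuation.\<close>

lemma ramanujan_zeta_eq:
  "ramanujan_zeta x = wilton_integral ((x - 6) / \<i>) * of_real (2 * pi) powr x * rGamma x"
proof -
  define f where "f x = wilton_integral ((x - 6) / \<i>) * of_real (2 * pi) powr x * rGamma x" for x
  have hol: "f holomorphic_on UNIV"
    unfolding f_def
    by (intro holomorphic_intros holomorphic_on_compose_gen[OF _ holomorphic_wilton_integral, unfolded o_def]) auto
  have eq: "f x = ramanujan_dirichlet_series x" if "Re x > 13 / 2" for x
  proof -
    have "rGamma x * Gamma x = 1"
      using that not_nonpos_Int_of_Re_pos[of x] by (simp add: rGamma_inverse_Gamma Gamma_eq_zero_iff)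
    moreover have "of_real (2 * pi) powr (-x) * of_real (2 * pi) powr x = (1 :: complex)"
      by (simp add: powr_minus)
    moreover have "f x = (of_real (2 * pi) powr (-x) * of_real (2 * pi) powr x) * (rGamma x * Gamma x)
        * ramanujan_dirichlet_series x"
      unfolding f_def wilton_integral_eq_dirichlet[OF that] by (simp only: mult_ac)
    ultimately show ?thesis by simp
  qed
  have "ramanujan_zeta = f"
    unfolding ramanujan_zeta_def
  proof (rule the_equality)
    fix g assume g: "g holomorphic_on UNIV \<and> (\<forall>x. 13 / 2 < Re x \<longrightarrow> g x = ramanujan_dirichlet_series x)"
    show "g = f" by (rule entire_eqI[of _ _ "13 / 2"]) (use g hol eq in auto)
  qed (use hol eq in auto)
  thus ?thesis unfolding f_def by (rule fun_cong)
qed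

lemma ramanujan_xi_eq: "ramanujan_xi x = wilton_integral ((x - 6) / \<i>)"
proof -
  define f where "f x = wilton_integral ((x - 6) / \<i>)" for x
  have hol: "f holomorphic_on UNIV"
    unfolding f_def
    by (intro holomorphic_intros holomorphic_on_compose_gen[OF _ holomorphic_wilton_integral, unfolded o_def]) auto
  have eq: "f x = of_real (2 * pi) powr (-x) * Gamma x * ramanujan_zeta x" if "x \<notin> \<int>\<^sub>\<le>\<^sub>0" for x
  proof -
    have "Gamma x * rGamma x = 1"
      using that by (simp add: rGamma_inverse_Gamma Gamma_eq_zero_iff)
    moreover have "of_real (2 * pi) powr (-x) * of_real (2 * pi) powr x = (1 :: complex)"
      by (simp add: powr_minus)
    moreover have "of_real (2 * pi) powr (-x) * Gamma x * ramanujan_zeta x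
        = (of_real (2 * pi) powr (-x) * of_real (2 * pi) powr x) * (Gamma x * rGamma x) * f x"
      unfolding f_def ramanujan_zeta_eq by (simp only: mult_ac)
    ultimately show ?thesis by simp
  qed
  have "ramanujan_xi = f"
    unfolding ramanujan_xi_def
  proof (rule the_equality)
    fix g assume g: "g holomorphic_on UNIV \<and>
      (\<forall>x. x \<notin> \<int>\<^sub>\<le>\<^sub>0 \<longrightarrow> g x = of_real (2 * pi) powr (-x) * Gamma x * ramanujan_zeta x)"
    show "g = f"
    \<comment> \<open>The half-plane Re x > 0 contains no pole of Gamma, so the product formula
      determines both functions there; the values at the poles follow by continuation.\<close>
    proof (rule entire_eqI[of _ _ 0])
      fix x :: complex assume "Re x > 0"
      from not_nonpos_Int_of_Re_pos[OF this] show "g x = f x" using g eq[of x] by simp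
    qed (use g hol in auto)
  qed (use hol eq in auto)
  thus ?thesis unfolding f_def by (rule fun_cong)
qed

theorem proposition2:
  fixes \<phi> :: complex
  shows "(\<lambda>s. chi s * (-1) ^ s * \<phi> ^ (2 * s)) sums ramanujan_wilton \<phi>"
  using chi_sums_wilton_integral[of \<phi>] by (simp add: ramanujan_wilton_def ramanujan_xi_eq)

end
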